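(* Let $c>0$ and $(m,\ell)\in\Lambda_c'$, and consider the map $X_{m,\ell}:\mathbb{R}^2\to\mathbb{S}^3_c$ defined by $X_{m,\ell}(s,t)=\phi_t(\alpha_{m,\ell}(s))$. Then $X_{m,\ell}$ defines an isometric immersion of the $c$-spherical Ricci surface $(\mathbb{R}^2,d\sigma_{m,\ell}^2)$ into $\mathbb{S}^3_c$. Moreover, if $\theta_{m,\ell}\left(\frac{\pi}{\sqrt c}\right)/2\pi\in\mathbb{Q}$, then $X_{m,\ell}(\mathbb{R}^2)$ is a compact surface in $\mathbb{S}^3_c$, and it is embedded when $\theta_{m,\ell}\left(\frac{\pi}{\sqrt c}\right)=2\pi/n$ for some positive integer $n$.
   Context: For $c>0$, $\mathbb{S}^3_c=\{(x,y,z,w)\in\mathbb{R}^4 : x^2+y^2+z^2+w^2=1/c\}$ with the metric induced from $\mathbb{R}^4$ (the sphere of sectional curvature $c$), and $\phi_t(x,y,z,w)=(x,y,z\cos t-w\sin t,z\sin t+w\cos t)$ for $t\in\mathbb{R}$. A Riemannian surface is called a $c$-spherical Ricci surface if its Gaussian curvature $K$ satisfies $(K-c)\Delta K-|\nabla K|^2-4K(K-c)^2=0$, with $\nabla$, $\Delta$ the gradient and Laplace–Beltrami operator of its metric. Let $\Lambda_c'=\left\{(m,\ell)\in\mathbb{R}^2 : 0<m<\frac1c \text{ and } \sqrt{c\,m}<\ell<\frac{c\,m+1}{2}\right\}$. For $(m,\ell)\in\Lambda_c'$ let $$f_{m,\ell}(s)=\sqrt{\frac{\ell+\sqrt{\ell^2-c\,m}\,\sin(2\sqrt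 c\,s)}{c}},\qquad s\in\mathbb{R},$$ (one has $0<f_{m,\ell}^2<1/c$), let $d\sigma_{m,\ell}^2=ds^2+f_{m,\ell}(s)^2\,dt^2$ on $\mathbb{R}^2$ with coordinates $(s,t)$, let $$\theta_{m,\ell}(s)=\sqrt c\int_0^s\frac{\sqrt{m+(1-2\ell)f_{m,\ell}(\varsigma)^2}}{f_{m,\ell}(\varsigma)\,(1-c\,f_{m,\ell}(\varsigma)^2)}\,d\varsigma,$$ which is well defined for all $s\in\mathbb{R}$, and let $\alpha_{m,\ell}:\mathbb{R}\to\mathbb{S}^3_c$ be the curve $$\alpha_{m,\ell}(s)=\left(\tfrac{1}{\sqrt c}\sqrt{1-c\,f_{m,\ell}(s)^2}\,\cos\theta_{m,\ell}(s),\ \tfrac{1}{\sqrt c}\sqrt{1-c\,f_{m,\ell}(s)^2}\,\sin\theta_{m,\ell}(s),\ f_{m,\ell}(s),\ 0\right).$$ *)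

theory Defs
  imports "HOL-Analysis.Analysis"
begin

section \<open>Smooth maps and immersions\<close>

fun times_cont_diff_on ::
    "nat \<Rightarrow> 'a::real_normed_vector set \<Rightarrow> ('a \<Rightarrow> 'b::real_normed_vector) \<Rightarrow> bool" where
  "times_cont_diff_on 0 U F \<longleftrightarrow> continuous_on U F"
| "times_cont_diff_on (Suc k) U F \<longleftrightarrow>
     (\<forall>p\<in>U. F differentiable (at p)) \<and>
     (\<forall>v. times_cont_diff_on k U (\<lambda>p. frechet_derivative F (at p) v))"

text \<open>Only meant for open \<^term>\<open>U\<close>, since derivatives are taken with respect to the full filter
  \<^term>\<open>at p\<close>.\<close>

definition smooth_map_on ::
    "'a::real_normed_vector set \<Rightarrow> ('a \<Rightarrow> 'b::real_normed_vector) \<Rightarrow> bool" where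
  "smooth_map_on U F \<longleftrightarrow> (\<forall>k. times_cont_diff_on k U F)"

definition smooth_immersion_on ::
    "'a::real_normed_vector set \<Rightarrow> ('a \<Rightarrow> 'b::real_normed_vector) \<Rightarrow> bool" where
  "smooth_immersion_on U F \<longleftrightarrow>
     smooth_map_on U F \<and> (\<forall>p\<in>U. inj (frechet_derivative F (at p)))"

section \<open>Riemannian metrics on the coordinate plane\<close>

text \<open>A metric is given by its matrix with respect to the global coordinates
  \<open>(s, t) = (p $ 1, p $ 2)\<close>.\<close>

definition riemannian_metric :: "(real^2 \<Rightarrow> real^2^2) \<Rightarrow> bool" where
  "riemannian_metric g \<longleftrightarrow>
     smooth_map_on UNIV g \<and>
     (\<forall>p. transpose (g p) = g p) \<and>
     (\<forall>p v. v \<noteq> 0 \<longrightarrow> v \<bullet> (g p *v v) > 0)"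

definition pderiv_at :: "2 \<Rightarrow> (real^2 \<Rightarrow> real) \<Rightarrow> real^2 \<Rightarrow> real" where
  "pderiv_at i u p = frechet_derivative u (at p) (axis i 1)"

text \<open>\<^term>\<open>christoffel g k i j\<close> is \<open>\<Gamma>\<^sup>k\<^sub>i\<^sub>j\<close>.\<close>

definition christoffel :: "(real^2 \<Rightarrow> real^2^2) \<Rightarrow> 2 \<Rightarrow> 2 \<Rightarrow> 2 \<Rightarrow> real^2 \<Rightarrow> real" where
  "christoffel g k i j p =
     (\<Sum>l\<in>UNIV. matrix_inv (g p) $ k $ l *
        (pderiv_at i (\<lambda>q. g q $ j $ l) p + pderiv_at j (\<lambda>q. g q $ i $ l) p
          - pderiv_at l (\<lambda>q. g q $ i $ j) p)) / 2"

text \<open>\<^term>\<open>curvature_coeff g l i j k\<close> is the \<open>l\<close>-th component of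
  \<open>R(\<partial>\<^sub>i, \<partial>\<^sub>j)\<partial>\<^sub>k = \<nabla>\<^sub>i\<nabla>\<^sub>j\<partial>\<^sub>k - \<nabla>\<^sub>j\<nabla>\<^sub>i\<partial>\<^sub>k\<close>.\<close>

definition curvature_coeff ::
    "(real^2 \<Rightarrow> real^2^2) \<Rightarrow> 2 \<Rightarrow> 2 \<Rightarrow> 2 \<Rightarrow> 2 \<Rightarrow> real^2 \<Rightarrow> real" where
  "curvature_coeff g l i j k p =
     pderiv_at i (christoffel g l j k) p - pderiv_at j (christoffel g l i k) p
     + (\<Sum>n\<in>UNIV. christoffel g n j k p * christoffel g l i n p
                 - christoffel g n i k p * christoffel g l j n p)"

text \<open>\<open>K = g(R(\<partial>\<^sub>1, \<partial>\<^sub>2)\<partial>\<^sub>2, \<partial>\<^sub>1) / det g\<close>, positive for round spheres.\<close>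

definition gauss_curvature :: "(real^2 \<Rightarrow> real^2^2) \<Rightarrow> real^2 \<Rightarrow> real" where
  "gauss_curvature g p =
     (\<Sum>l\<in>UNIV. g p $ 1 $ l * curvature_coeff g l 1 2 2 p) / det (g p)"

definition metric_gradient ::
    "(real^2 \<Rightarrow> real^2^2) \<Rightarrow> (real^2 \<Rightarrow> real) \<Rightarrow> real^2 \<Rightarrow> real^2" where
  "metric_gradient g u p = matrix_inv (g p) *v (\<chi> i. pderiv_at i u p)"

definition metric_norm_sq :: "(real^2 \<Rightarrow> real^2^2) \<Rightarrow> real^2 \<Rightarrow> real^2 \<Rightarrow> real" where
  "metric_norm_sq g p v = v \<bullet> (g p *v v)"

definition laplace_beltrami ::
    "(real^2 \<Rightarrow> real^2^2) \<Rightarrow> (real^2 \<Rightarrow> real) \<Rightarrow> real^2 \<Rightarrow> real" where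
  "laplace_beltrami g u p =
     (\<Sum>i\<in>UNIV. pderiv_at i (\<lambda>q. sqrt (det (g q)) * metric_gradient g u q $ i) p)
       / sqrt (det (g p))"

definition spherical_ricci_surface :: "real \<Rightarrow> (real^2 \<Rightarrow> real^2^2) \<Rightarrow> bool" where
  "spherical_ricci_surface c g \<longleftrightarrow>
     riemannian_metric g \<and>
     (\<forall>p. let K = gauss_curvature g in
        (K p - c) * laplace_beltrami g K p - metric_norm_sq g p (metric_gradient g K p)
          - 4 * K p * (K p - c)\<^sup>2 = 0)"

section \<open>Surfaces in a submanifold of Euclidean space\<close>

text \<open>Throughout, the target \<^term>\<open>N\<close> is an embedded submanifold of the ambient Euclidean space
  with the induced metric, so that smooth maps and immersions into \<^term>\<open>N\<close> are those into the
  ambient space with values in \<^term>\<open>N\<close>.\<close>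

definition isometric_immersion ::
    "(real^2 \<Rightarrow> real^2^2) \<Rightarrow> 'a::euclidean_space set \<Rightarrow> (real^2 \<Rightarrow> 'a) \<Rightarrow> bool" where
  "isometric_immersion g N F \<longleftrightarrow>
     range F \<subseteq> N \<and> smooth_immersion_on UNIV F \<and>
     (\<forall>p u v. frechet_derivative F (at p) u \<bullet> frechet_derivative F (at p) v = u \<bullet> (g p *v v))"

definition local_parametrization ::
    "'a::euclidean_space set \<Rightarrow> (real^2) set \<Rightarrow> (real^2 \<Rightarrow> 'a) \<Rightarrow> bool" where
  "local_parametrization M U x \<longleftrightarrow>
     open U \<and> smooth_immersion_on U x \<and> openin (top_of_set M) (x ` U) \<and>
     (\<exists>y. homeomorphism U (x ` U) x y)"

text \<open>Embedded two-dimensional submanifolds without boundary.\<close>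

definition regular_surface :: "'a::euclidean_space set \<Rightarrow> bool" where
  "regular_surface M \<longleftrightarrow> (\<forall>p\<in>M. \<exists>U x. local_parametrization M U x \<and> p \<in> x ` U)"

text \<open>As usual it does not matter which parametrization around a point is used to test whether a
  map on \<^term>\<open>M\<close> is an immersion.\<close>

definition surface_immersion ::
    "'a::euclidean_space set \<Rightarrow> 'b::euclidean_space set \<Rightarrow> ('a \<Rightarrow> 'b) \<Rightarrow> bool" where
  "surface_immersion M N F \<longleftrightarrow>
     F ` M \<subseteq> N \<and>
     (\<forall>p\<in>M. \<exists>U x. local_parametrization M U x \<and> p \<in> x ` U \<and> smooth_immersion_on U (F \<circ> x))"

text \<open>The image of \<^term>\<open>X\<close> is a compact, possibly self-intersecting, surface in \<^term>\<open>N\<close>: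
  \<^term>\<open>X\<close> descends along a local diffeomorphism \<^term>\<open>q\<close> from the plane onto a compact surface
  \<^term>\<open>M\<close> without boundary to an immersion \<^term>\<open>F\<close> of \<^term>\<open>M\<close>, so that the image of
  \<^term>\<open>X\<close> is \<^term>\<open>F ` M\<close>.  Realizing \<^term>\<open>M\<close> inside \<open>\<real>\<^sup>4\<close> is no restriction, as every compact
  surface embeds there.  An immersion \<^term>\<open>q\<close> between surfaces is a local diffeomorphism.\<close>

definition image_is_compact_surface ::
    "'b::euclidean_space set \<Rightarrow> (real^2 \<Rightarrow> 'b) \<Rightarrow> bool" where
  "image_is_compact_surface N X \<longleftrightarrow>
     (\<exists>(M :: (real^4) set) q F.
        compact M \<and> regular_surface M \<and>
        smooth_immersion_on UNIV q \<and> range q = M \<and>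
        surface_immersion M N F \<and> X = F \<circ> q)"

definition embedded_surface_in :: "'a::euclidean_space set \<Rightarrow> 'a set \<Rightarrow> bool" where
  "embedded_surface_in N S \<longleftrightarrow> S \<subseteq> N \<and> regular_surface S"

section \<open>The rotational surfaces\<close>

definition S3 :: "real \<Rightarrow> (real^4) set" where
  "S3 c = {p. (p $ 1)\<^sup>2 + (p $ 2)\<^sup>2 + (p $ 3)\<^sup>2 + (p $ 4)\<^sup>2 = 1 / c}"

definition rotation :: "real \<Rightarrow> real^4 \<Rightarrow> real^4" where
  "rotation t p =
     vector [p $ 1, p $ 2, p $ 3 * cos t - p $ 4 * sin t, p $ 3 * sin t + p $ 4 * cos t]"

definition Lambda' :: "real \<Rightarrow> (real \<times> real) set" where
  "Lambda' c = {(m, l). 0 < m \<and> m < 1 / c \<and> sqrt (c * m) < l \<and> l < (c * m + 1) / 2}"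

definition profile :: "real \<Rightarrow> real \<Rightarrow> real \<Rightarrow> real \<Rightarrow> real" where
  "profile c m l s = sqrt ((l + sqrt (l\<^sup>2 - c * m) * sin (2 * sqrt c * s)) / c)"

definition warped_metric :: "real \<Rightarrow> real \<Rightarrow> real \<Rightarrow> real^2 \<Rightarrow> real^2^2" where
  "warped_metric c m l p = vector [vector [1, 0], vector [0, (profile c m l (p $ 1))\<^sup>2]]"

text \<open>The interval integral is oriented, as needed for negative \<^term>\<open>s\<close>.\<close>

definition angle :: "real \<Rightarrow> real \<Rightarrow> real \<Rightarrow> real \<Rightarrow> real" where
  "angle c m l s =
     sqrt c * (LBINT r=0..s. sqrt (m + (1 - 2 * l) * (profile c m l r)\<^sup>2)
                 / (profile c m l r * (1 - c * (profile c m l r)\<^sup>2)))"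

definition profile_curve :: "real \<Rightarrow> real \<Rightarrow> real \<Rightarrow> real \<Rightarrow> real^4" where
  "profile_curve c m l s =
     vector [1 / sqrt c * sqrt (1 - c * (profile c m l s)\<^sup>2) * cos (angle c m l s),
             1 / sqrt c * sqrt (1 - c * (profile c m l s)\<^sup>2) * sin (angle c m l s),
             profile c m l s, 0]"

definition rotational_surface :: "real \<Rightarrow> real \<Rightarrow> real \<Rightarrow> real^2 \<Rightarrow> real^4" where
  "rotational_surface c m l p = rotation (p $ 2) (profile_curve c m l (p $ 1))"

end

theory Submission
  imports Defs
begin

text \<open>
  Everything is governed by the squared profile \<open>h = f\<^sup>2\<close>, which oscillates harmonically: with
  \<open>A = sqrt (l\<^sup>2 - c m)\<close> one has \<open>c h = l + A sin (2 sqrt c s)\<close>, hence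
  \<open>h'' = 4 (l - c h)\<close> and \<open>h'\<^sup>2 = 4 (2 l h - c h\<^sup>2 - m)\<close>.  The conditions on \<open>(m, l)\<close> give
  \<open>0 < l - A\<close> and \<open>l + A < 1\<close>, so that \<open>0 < c h < 1\<close>; since \<open>c m = (l - A) (l + A)\<close>, they also make
  \<open>m + (1 - 2 l) h\<close> positive, and therefore every square root in sight is smooth.

  Ricci condition.  For a metric \<open>ds\<^sup>2 + h(s) dt\<^sup>2\<close> the curvature is
  \<open>h'\<^sup>2 / (4 h\<^sup>2) - h'' / (2 h)\<close>, which the two equations for \<open>h\<close> turn into \<open>K = c - m / h\<^sup>2\<close>.  As
  \<open>K\<close> depends on \<open>s\<close> alone, the Ricci equation becomes an ordinary differential equation for \<open>h\<close>,
  and it is again a consequence of these two equations.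

  Isometry.  The map is \<open>(s, t) \<mapsto> (r e\<^sup>i\<^sup>\<theta>, f e\<^sup>i\<^sup>t)\<close> in \<open>\<complex>\<^sup>2\<close>, where \<open>r\<^sup>2 = (1 - c h) / c\<close>.  A map of
  this form induces the metric \<open>(r'\<^sup>2 + r\<^sup>2 \<theta>'\<^sup>2 + f'\<^sup>2) ds\<^sup>2 + f\<^sup>2 dt\<^sup>2\<close>, and \<open>\<theta>\<close> is chosen exactly so that
  the first coefficient is \<open>1\<close>.  Injectivity of the differential follows from the induced metric being
  positive definite.

  Global part.  An immersion of the plane whose fibres are the orbits of a lattice of translations
  has as image an embedded compact surface: a period cell parametrizes the complement of the compact
  image of the rest of the closed cell.  The functions \<open>f\<close> and \<open>r\<close> have period \<open>T = pi / sqrt c\<close>, while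
  \<open>\<theta>(s + T) = \<theta>(s) + \<theta>(T)\<close> and \<open>\<theta>\<close> is strictly increasing.  If \<open>n \<theta>(T) = 2 pi\<close>, then \<open>\<theta>\<close> gains
  exactly one turn per period \<open>n T\<close>, so the fibres are the orbits of the lattice
  \<open>n T \<int> \<times> 2 pi \<int>\<close> and the image is embedded.  If only \<open>b \<theta>(T)\<close> is a multiple of \<open>2 pi\<close>, the map is still
  invariant under \<open>b T \<int> \<times> 2 pi \<int>\<close> and descends to an immersion of the torus \<open>S\<^sup>1 \<times> S\<^sup>1\<close>, which is
  itself the image of an immersion with these orbits as its fibres.
\<close>

section \<open>Calculus of smooth maps\<close>

lemma times_cont_diff_on_subset:
  assumes "times_cont_diff_on k U F" "V \<subseteq> U"
  shows "times_cont_diff_on k V F"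
  using assms
proof (induction k arbitrary: F)
  case 0
  then show ?case using continuous_on_subset by auto
next
  case (Suc k)
  then show ?case by auto
qed

lemma smooth_immersion_on_subset:
  "smooth_immersion_on U F \<Longrightarrow> V \<subseteq> U \<Longrightarrow> smooth_immersion_on V F"
  unfolding smooth_immersion_on_def smooth_map_on_def
  using times_cont_diff_on_subset by blast

text \<open>The recursion in \<^const>\<open>times_cont_diff_on\<close> is phrased through \<^const>\<open>frechet_derivative\<close>.  The next
  two lemmas trade it for an arbitrary family of derivatives, so that the closure properties below
  reduce, by induction on the order, to the familiar differentiation rules.\<close>
lemma times_cont_diff_SucI:
  assumes "\<And>p. (F has_derivative D p) (at p)"
    and "\<And>v. times_cont_diff_on k UNIV (\<lambda>p. D p v)"
  shows "times_cont_diff_on (Suc k) UNIV F"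
proof -
  have "frechet_derivative F (at p) = D p" for p
    using frechet_derivative_at[OF assms(1)] by simp
  then show ?thesis
    using assms by (auto simp: differentiable_def)
qed

lemma times_cont_diff_SucE:
  assumes "times_cont_diff_on (Suc k) UNIV F"
  obtains D where "\<And>p. (F has_derivative D p) (at p)"
    and "\<And>v. times_cont_diff_on k UNIV (\<lambda>p. D p v)"
proof
  show "(F has_derivative frechet_derivative F (at p)) (at p)" for p
    using assms frechet_derivative_works by auto
  show "times_cont_diff_on k UNIV (\<lambda>p. frechet_derivative F (at p) v)" for v
    using assms by simp
qed

lemma times_cont_diff_Suc_imp:
  "times_cont_diff_on (Suc k) UNIV F \<Longrightarrow> times_cont_diff_on k UNIV F"
proof (induction k arbitrary: F)
  case 0
  then show ?case
    by (auto intro!: differentiable_imp_continuous_on simp: differentiable_on_def)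
next
  case (Suc k)
  have "\<forall>p. F differentiable (at p)"
    using Suc.prems by auto
  moreover have "times_cont_diff_on k UNIV (\<lambda>p. frechet_derivative F (at p) v)" for v
    by (rule Suc.IH) (use Suc.prems in auto)
  ultimately show ?case by simp
qed

lemma times_cont_diff_const: "times_cont_diff_on k UNIV (\<lambda>p. a)"
proof (induction k arbitrary: a)
  case (Suc k)
  show ?case
    by (rule times_cont_diff_SucI[where D="\<lambda>p v. 0"]) (auto intro: Suc)
qed auto

lemma times_cont_diff_bounded_linear:
  assumes L: "bounded_linear L"
  shows "times_cont_diff_on k UNIV F \<Longrightarrow> times_cont_diff_on k UNIV (\<lambda>p. L (F p))"
proof (induction k arbitrary: F)
  case 0
  then show ?case using bounded_linear.continuous_on[OF L] by auto
next
  case (Suc k)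
  obtain D where D: "\<And>p. (F has_derivative D p) (at p)"
      "\<And>v. times_cont_diff_on k UNIV (\<lambda>p. D p v)"
    by (rule times_cont_diff_SucE[OF Suc.prems]) (rule that)
  show ?case
    by (rule times_cont_diff_SucI[where D="\<lambda>p v. L (D p v)"])
      (auto intro!: bounded_linear.has_derivative[OF L] D Suc.IH)
qed

lemma times_cont_diff_compose_linear:
  assumes L: "bounded_linear L"
  shows "times_cont_diff_on k UNIV F \<Longrightarrow> times_cont_diff_on k UNIV (\<lambda>p. F (L p))"
proof (induction k arbitrary: F)
  case 0
  then show ?case
    using continuous_on_compose2[of UNIV F UNIV L] linear_continuous_on[OF L] by auto
next
  case (Suc k)
  obtain D where D: "\<And>p. (F has_derivative D p) (at p)"
      "\<And>v. times_cont_diff_on k UNIV (\<lambda>p. D p v)"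
    by (rule times_cont_diff_SucE[OF Suc.prems]) (rule that)
  show ?case
  proof (rule times_cont_diff_SucI[where D="\<lambda>p v. D (L p) (L v)"])
    show "((\<lambda>p. F (L p)) has_derivative (\<lambda>v. D (L p) (L v))) (at p)" for p
      using has_derivative_compose[OF bounded_linear_imp_has_derivative[OF L] D(1)] .
    show "times_cont_diff_on k UNIV (\<lambda>p. D (L p) (L v))" for v
      by (rule Suc.IH[OF D(2)])
  qed
qed

lemma times_cont_diff_add:
  "times_cont_diff_on k UNIV F \<Longrightarrow> times_cont_diff_on k UNIV G \<Longrightarrow>
   times_cont_diff_on k UNIV (\<lambda>p. F p + G p)"
proof (induction k arbitrary: F G)
  case 0
  then show ?case by (auto intro: continuous_on_add)
next
  case (Suc k)
  obtain D where D: "\<And>p. (F has_derivative D p) (at p)"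
      "\<And>v. times_cont_diff_on k UNIV (\<lambda>p. D p v)"
    by (rule times_cont_diff_SucE[OF Suc.prems(1)]) (rule that)
  obtain E where E: "\<And>p. (G has_derivative E p) (at p)"
      "\<And>v. times_cont_diff_on k UNIV (\<lambda>p. E p v)"
    by (rule times_cont_diff_SucE[OF Suc.prems(2)]) (rule that)
  show ?case
    by (rule times_cont_diff_SucI[where D="\<lambda>p v. D p v + E p v"])
      (auto intro!: has_derivative_add D E Suc.IH)
qed

lemma times_cont_diff_mult:
  fixes F G :: "'a::real_normed_vector \<Rightarrow> real"
  shows "times_cont_diff_on k UNIV F \<Longrightarrow> times_cont_diff_on k UNIV G \<Longrightarrow>
   times_cont_diff_on k UNIV (\<lambda>p. F p * G p)"
proof (induction k arbitrary: F G)
  case 0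
  then show ?case by (auto intro: continuous_on_mult)
next
  case (Suc k)
  obtain D where D: "\<And>p. (F has_derivative D p) (at p)"
      "\<And>v. times_cont_diff_on k UNIV (\<lambda>p. D p v)"
    by (rule times_cont_diff_SucE[OF Suc.prems(1)]) (rule that)
  obtain E where E: "\<And>p. (G has_derivative E p) (at p)"
      "\<And>v. times_cont_diff_on k UNIV (\<lambda>p. E p v)"
    by (rule times_cont_diff_SucE[OF Suc.prems(2)]) (rule that)
  note lower = Suc.prems[THEN times_cont_diff_Suc_imp]
  show ?case
    by (rule times_cont_diff_SucI[where D="\<lambda>p v. F p * E p v + D p v * G p"])
      (auto intro!: has_derivative_mult times_cont_diff_add D E Suc.IH lower)
qed

text \<open>Inverse, square root, sine and cosine need no higher chain rule: each satisfies a first-order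
  differential equation, so its derivative is a product of the derivative of the inner map with
  functions that are already known to be of the lower order.\<close>
lemma times_cont_diff_inverse:
  fixes F :: "'a::real_normed_vector \<Rightarrow> real"
  assumes nz: "\<And>p. F p \<noteq> 0"
  shows "times_cont_diff_on k UNIV F \<Longrightarrow> times_cont_diff_on k UNIV (\<lambda>p. inverse (F p))"
proof (induction k)
  case 0
  then show ?case using nz by (auto intro: continuous_on_inverse)
next
  case (Suc k)
  obtain D where D: "\<And>p. (F has_derivative D p) (at p)"
      "\<And>v. times_cont_diff_on k UNIV (\<lambda>p. D p v)"
    by (rule times_cont_diff_SucE[OF Suc.prems(1)]) (rule that)
  note inv = Suc.IH[OF times_cont_diff_Suc_imp[OF Suc.prems]]
  show ?case
  proof (rule times_cont_diff_SucI[where D="\<lambda>p v. - 1 * (inverse (F p) * D p v * inverse (F p))"])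
    show "((\<lambda>p. inverse (F p)) has_derivative (\<lambda>v. - 1 * (inverse (F p) * D p v * inverse (F p)))) (at p)" for p
      using Deriv.has_derivative_inverse[OF nz D(1)] by simp
    show "times_cont_diff_on k UNIV (\<lambda>p. - 1 * (inverse (F p) * D p v * inverse (F p)))" for v
      by (intro times_cont_diff_mult times_cont_diff_const inv D)
  qed
qed

lemma times_cont_diff_sqrt:
  fixes F :: "'a::real_normed_vector \<Rightarrow> real"
  assumes pos: "\<And>p. F p > 0"
  shows "times_cont_diff_on k UNIV F \<Longrightarrow> times_cont_diff_on k UNIV (\<lambda>p. sqrt (F p))"
proof (induction k)
  case 0
  then show ?case by (auto intro: continuous_on_real_sqrt)
next
  case (Suc k)
  obtain D where D: "\<And>p. (F has_derivative D p) (at p)"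
      "\<And>v. times_cont_diff_on k UNIV (\<lambda>p. D p v)"
    by (rule times_cont_diff_SucE[OF Suc.prems(1)]) (rule that)
  have nz: "sqrt (F p) \<noteq> 0" for p
    using pos[of p] by simp
  note root = Suc.IH[OF times_cont_diff_Suc_imp[OF Suc.prems]]
  show ?case
  proof (rule times_cont_diff_SucI[where D="\<lambda>p v. D p v * (inverse (sqrt (F p)) * (1/2))"])
    show "((\<lambda>p. sqrt (F p)) has_derivative (\<lambda>v. D p v * (inverse (sqrt (F p)) * (1/2)))) (at p)" for p
      by (rule has_derivative_eq_rhs, rule DERIV_compose_FDERIV[OF DERIV_real_sqrt[OF pos[of p]] D(1)])
        (simp add: fun_eq_iff)
    show "times_cont_diff_on k UNIV (\<lambda>p. D p v * (inverse (sqrt (F p)) * (1/2)))" for v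
      by (intro times_cont_diff_mult times_cont_diff_inverse times_cont_diff_const root D nz)
  qed
qed

lemma times_cont_diff_sin_cos:
  fixes F :: "'a::real_normed_vector \<Rightarrow> real"
  shows "times_cont_diff_on k UNIV F \<Longrightarrow>
    times_cont_diff_on k UNIV (\<lambda>p. sin (F p)) \<and> times_cont_diff_on k UNIV (\<lambda>p. cos (F p))"
proof (induction k)
  case 0
  then show ?case by (auto intro: continuous_on_sin continuous_on_cos)
next
  case (Suc k)
  obtain D where D: "\<And>p. (F has_derivative D p) (at p)"
      "\<And>v. times_cont_diff_on k UNIV (\<lambda>p. D p v)"
    by (rule times_cont_diff_SucE[OF Suc.prems(1)]) (rule that)
  note trig = Suc.IH[OF times_cont_diff_Suc_imp[OF Suc.prems]]
  have "times_cont_diff_on (Suc k) UNIV (\<lambda>p. sin (F p))"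
  proof (rule times_cont_diff_SucI[where D="\<lambda>p v. D p v * cos (F p)"])
    show "((\<lambda>p. sin (F p)) has_derivative (\<lambda>v. D p v * cos (F p))) (at p)" for p
      by (auto intro!: derivative_eq_intros D)
    show "times_cont_diff_on k UNIV (\<lambda>p. D p v * cos (F p))" for v
      using trig by (intro times_cont_diff_mult D) auto
  qed
  moreover have "times_cont_diff_on (Suc k) UNIV (\<lambda>p. cos (F p))"
  proof (rule times_cont_diff_SucI[where D="\<lambda>p v. D p v * (sin (F p) * - 1)"])
    show "((\<lambda>p. cos (F p)) has_derivative (\<lambda>v. D p v * (sin (F p) * - 1))) (at p)" for p
      by (auto intro!: derivative_eq_intros D)
    show "times_cont_diff_on k UNIV (\<lambda>p. D p v * (sin (F p) * - 1))" for v
      using trig by (intro times_cont_diff_mult times_cont_diff_const D) auto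
  qed
  ultimately show ?case ..
qed

lemma smooth_const: "smooth_map_on UNIV (\<lambda>p. a)"
  by (simp add: smooth_map_on_def times_cont_diff_const)

lemma smooth_bounded_linear:
  "bounded_linear L \<Longrightarrow> smooth_map_on UNIV F \<Longrightarrow> smooth_map_on UNIV (\<lambda>p. L (F p))"
  using times_cont_diff_bounded_linear[of L _ F] by (simp add: smooth_map_on_def)

lemma smooth_compose_linear:
  "bounded_linear L \<Longrightarrow> smooth_map_on UNIV F \<Longrightarrow> smooth_map_on UNIV (\<lambda>p. F (L p))"
  using times_cont_diff_compose_linear[of L _ F] by (simp add: smooth_map_on_def)

lemma smooth_linear:
  assumes L: "bounded_linear L"
  shows "smooth_map_on UNIV L"
  unfolding smooth_map_on_def
proof
  fix k
  show "times_cont_diff_on k UNIV L"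
  proof (cases k)
    case 0
    then show ?thesis using linear_continuous_on[OF L] by simp
  next
    case (Suc n)
    have "times_cont_diff_on (Suc n) UNIV L"
      by (rule times_cont_diff_SucI[where D="\<lambda>p. L"])
        (auto intro: bounded_linear_imp_has_derivative L times_cont_diff_const)
    then show ?thesis using Suc by simp
  qed
qed

lemma smooth_add:
  "smooth_map_on UNIV F \<Longrightarrow> smooth_map_on UNIV G \<Longrightarrow> smooth_map_on UNIV (\<lambda>p. F p + G p)"
  by (simp add: smooth_map_on_def times_cont_diff_add)

context
  fixes F G :: "'a::real_normed_vector \<Rightarrow> real"
  assumes F: "smooth_map_on UNIV F"
begin

lemma smooth_mult: "smooth_map_on UNIV G \<Longrightarrow> smooth_map_on UNIV (\<lambda>p. F p * G p)"
  using F by (simp add: smooth_map_on_def times_cont_diff_mult)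

lemma smooth_sqrt: "(\<And>p. F p > 0) \<Longrightarrow> smooth_map_on UNIV (\<lambda>p. sqrt (F p))"
  using F by (simp add: smooth_map_on_def times_cont_diff_sqrt)

lemma smooth_sin: "smooth_map_on UNIV (\<lambda>p. sin (F p))"
  and smooth_cos: "smooth_map_on UNIV (\<lambda>p. cos (F p))"
  using F by (simp_all add: smooth_map_on_def times_cont_diff_sin_cos)

end

lemma smooth_divide:
  fixes F G :: "'a::real_normed_vector \<Rightarrow> real"
  assumes "smooth_map_on UNIV F" "smooth_map_on UNIV G" "\<And>p. G p \<noteq> 0"
  shows "smooth_map_on UNIV (\<lambda>p. F p / G p)"
  using assms
  by (simp add: smooth_map_on_def times_cont_diff_mult times_cont_diff_inverse divide_inverse)

lemma smooth_diff:
  fixes F G :: "'a::real_normed_vector \<Rightarrow> real"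
  assumes "smooth_map_on UNIV F" "smooth_map_on UNIV G"
  shows "smooth_map_on UNIV (\<lambda>p. F p - G p)"
  using smooth_add[OF assms(1) smooth_mult[OF assms(2) smooth_const[of "-1"]]] by simp

text \<open>This is how smoothness of the angle function is obtained, which is only given as an integral.\<close>
lemma smooth_antiderivative:
  fixes F G :: "real \<Rightarrow> real"
  assumes F: "\<And>x. (F has_real_derivative G x) (at x)" and G: "smooth_map_on UNIV G"
  shows "smooth_map_on UNIV F"
  unfolding smooth_map_on_def
proof
  fix k
  have "times_cont_diff_on (Suc k) UNIV F"
  proof (rule times_cont_diff_SucI)
    show "(F has_derivative (\<lambda>v. G x * v)) (at x)" for x
      using F[of x] by (simp add: has_field_derivative_def)
    show "times_cont_diff_on k UNIV (\<lambda>x. G x * v)" for v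
      using G by (intro times_cont_diff_mult times_cont_diff_const) (simp add: smooth_map_on_def)
  qed
  then show "times_cont_diff_on k UNIV F"
    by (rule times_cont_diff_Suc_imp)
qed

lemma smooth_componentwise:
  fixes F :: "'a::real_normed_vector \<Rightarrow> 'b::real_normed_vector ^ 'n"
  assumes "\<And>i. smooth_map_on UNIV (\<lambda>p. F p $ i)"
  shows "smooth_map_on UNIV F"
proof -
  have ax: "bounded_linear (axis i :: 'b \<Rightarrow> 'b ^ 'n)" for i
  proof (rule bounded_linear_intro[where K=1])
    show "norm (axis i x :: 'b ^ 'n) \<le> norm x * 1" for x :: 'b
    proof -
      have "(norm ((axis i x :: 'b ^ 'n) $ j))\<^sup>2 = (if j = i then (norm x)\<^sup>2 else 0)" for j
        by (auto simp: axis_def)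
      then show ?thesis
        by (simp add: norm_vec_def L2_set_def)
    qed
  qed (simp_all add: vec_eq_iff axis_def)
  have fin: "smooth_map_on UNIV (\<lambda>p. \<Sum>i\<in>A. axis i (F p $ i))" if "finite A" for A
    using that
  proof induction
    case empty
    then show ?case by (simp add: smooth_const)
  next
    case (insert i A)
    then show ?case
      using smooth_add[OF smooth_bounded_linear[OF ax assms[of i]] insert.IH] by simp
  qed
  have "(\<Sum>i\<in>UNIV. axis i (F p $ i)) $ j = F p $ j" for p j
  proof -
    have "axis i (F p $ i) $ j = (if i = j then F p $ j else 0)" for i
      by (auto simp: axis_def)
    then show ?thesis by (simp add: sum_component)
  qed
  then have "(\<lambda>p. \<Sum>i\<in>UNIV. axis i (F p $ i)) = F"
    by (simp add: vec_eq_iff fun_eq_iff)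
  with fin[of UNIV] show ?thesis by simp
qed

section \<open>Double rotations\<close>
lemma vector_4_nth:
  "(vector [x, y, z, w] :: 'a::zero^4) $ 1 = x"
  "(vector [x, y, z, w] :: 'a^4) $ 2 = y"
  "(vector [x, y, z, w] :: 'a^4) $ 3 = z"
  "(vector [x, y, z, w] :: 'a^4) $ 4 = w"
  unfolding vector_def by auto

lemma has_derivative_vec_componentwise:
  fixes F :: "'a::real_normed_vector \<Rightarrow> real ^ 'n"
  assumes "\<And>i. ((\<lambda>p. F p $ i) has_derivative (\<lambda>v. D v $ i)) (at p)"
  shows "(F has_derivative D) (at p)"
  using assms
  by (subst has_derivative_componentwise_within) (auto simp: Basis_vec_def inner_axis)

lemma has_derivative_of_coordinate:
  fixes \<phi> :: "real \<Rightarrow> real" and p :: "real ^ 'n"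
  assumes "(\<phi> has_real_derivative d) (at (p $ i))"
  shows "((\<lambda>q. \<phi> (q $ i)) has_derivative (\<lambda>v. d * v $ i)) (at p)"
  using DERIV_compose_FDERIV[OF assms
      bounded_linear_imp_has_derivative[OF bounded_linear_vec_nth]]
  by (simp add: mult.commute)

text \<open>In \<open>\<complex>\<^sup>2\<close> this is \<open>(s, t) \<mapsto> (r e\<^sup>i\<^sup>\<theta>, f e\<^sup>i\<^sup>t)\<close>.  Both the rotational surfaces and the standard torus onto
  which they descend have this form.\<close>
definition double_rotation ::
    "(real \<Rightarrow> real) \<Rightarrow> (real \<Rightarrow> real) \<Rightarrow> (real \<Rightarrow> real) \<Rightarrow> real^2 \<Rightarrow> real^4" where
  "double_rotation r \<theta> f p =
     vector [r (p $ 1) * cos (\<theta> (p $ 1)), r (p $ 1) * sin (\<theta> (p $ 1)),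
             f (p $ 1) * cos (p $ 2), f (p $ 1) * sin (p $ 2)]"

lemma smooth_double_rotation:
  assumes "smooth_map_on UNIV r" "smooth_map_on UNIV \<theta>" "smooth_map_on UNIV f"
  shows "smooth_map_on UNIV (double_rotation r \<theta> f)"
proof -
  note coord = smooth_compose_linear[OF bounded_linear_vec_nth]
  have t: "smooth_map_on UNIV (\<lambda>p::real^2. p $ 2)"
    by (rule smooth_linear[OF bounded_linear_vec_nth])
  have "smooth_map_on UNIV (\<lambda>p. double_rotation r \<theta> f p $ i)" for i
  proof -
    consider "i = 1" | "i = 2" | "i = 3" | "i = 4"
      using exhaust_4 by blast
    then show ?thesis
      by cases (simp_all add: double_rotation_def vector_4_nth smooth_mult smooth_sin smooth_cos
          t coord[OF assms(1)] coord[OF assms(2)] coord[OF assms(3)])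
  qed
  then show ?thesis
    by (rule smooth_componentwise)
qed

context
  fixes r r' \<theta> \<theta>' f f' :: "real \<Rightarrow> real"
  assumes r': "\<And>s. (r has_real_derivative r' s) (at s)"
    and \<theta>': "\<And>s. (\<theta> has_real_derivative \<theta>' s) (at s)"
    and f': "\<And>s. (f has_real_derivative f' s) (at s)"
begin

lemma frechet_derivative_double_rotation:
  "frechet_derivative (double_rotation r \<theta> f) (at p) =
     (\<lambda>v. vector [(r' (p $ 1) * cos (\<theta> (p $ 1)) - r (p $ 1) * \<theta>' (p $ 1) * sin (\<theta> (p $ 1))) * v $ 1,
                 (r' (p $ 1) * sin (\<theta> (p $ 1)) + r (p $ 1) * \<theta>' (p $ 1) * cos (\<theta> (p $ 1))) * v $ 1,
                 f' (p $ 1) * cos (p $ 2) * v $ 1 - f (p $ 1) * sin (p $ 2) * v $ 2,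
                 f' (p $ 1) * sin (p $ 2) * v $ 1 + f (p $ 1) * cos (p $ 2) * v $ 2])"
  (is "_ = ?D")
proof -
  note [derivative_intros] =
    has_derivative_of_coordinate[OF r'[of "p $ 1"]]
    has_derivative_of_coordinate[OF \<theta>'[of "p $ 1"]]
    has_derivative_of_coordinate[OF f'[of "p $ 1"]]
    has_derivative_of_coordinate[where p=p and i=2, OF DERIV_sin]
    has_derivative_of_coordinate[where p=p and i=2, OF DERIV_cos]
    has_derivative_of_coordinate[OF DERIV_chain2[OF DERIV_sin \<theta>'[of "p $ 1"]]]
    has_derivative_of_coordinate[OF DERIV_chain2[OF DERIV_cos \<theta>'[of "p $ 1"]]]
  have "(double_rotation r \<theta> f has_derivative ?D) (at p)"
  proof (rule has_derivative_vec_componentwise)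
    fix i :: 4
    consider "i = 1" | "i = 2" | "i = 3" | "i = 4"
      using exhaust_4 by blast
    then show "((\<lambda>p. double_rotation r \<theta> f p $ i) has_derivative (\<lambda>v. ?D v $ i)) (at p)"
      by cases (simp only: double_rotation_def vector_4_nth,
          rule has_derivative_eq_rhs, rule derivative_intros, rule derivative_intros,
          rule derivative_intros, simp add: fun_eq_iff algebra_simps)+
  qed
  then show ?thesis
    by (simp add: frechet_derivative_at[symmetric])
qed

text \<open>There is no mixed term: in the second plane the \<open>s\<close>-lines move radially and the \<open>t\<close>-lines along
  circles, and in the first plane the \<open>t\<close>-lines do not move at all.\<close>
lemma inner_frechet_derivative_double_rotation:
  "frechet_derivative (double_rotation r \<theta> f) (at p) u \<bullet>
     frechet_derivative (double_rotation r \<theta> f) (at p) v =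
   ((r' (p $ 1))\<^sup>2 + (r (p $ 1) * \<theta>' (p $ 1))\<^sup>2 + (f' (p $ 1))\<^sup>2) * (u $ 1 * v $ 1)
     + (f (p $ 1))\<^sup>2 * (u $ 2 * v $ 2)"
proof -
  \<comment> \<open>Given this relation for both angles, the claim is a polynomial identity.\<close>
  have a: "(cos x)\<^sup>2 = 1 - (sin x)\<^sup>2" for x :: real
    by (simp add: cos_squared_eq)
  show ?thesis
    unfolding frechet_derivative_double_rotation inner_vec_def sum_4 vector_4_nth inner_real_def
    using a[of "\<theta> (p $ 1)"] a[of "p $ 2"]
    by algebra
qed

lemma smooth_immersion_double_rotation:
  assumes "smooth_map_on UNIV r" "smooth_map_on UNIV \<theta>" "smooth_map_on UNIV f"
    and E: "\<And>s. (r' s)\<^sup>2 + (r s * \<theta>' s)\<^sup>2 + (f' s)\<^sup>2 > 0" and f: "\<And>s. f s \<noteq> 0"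
  shows "smooth_immersion_on UNIV (double_rotation r \<theta> f)"
  unfolding smooth_immersion_on_def
proof (intro conjI ballI)
  show smooth: "smooth_map_on UNIV (double_rotation r \<theta> f)"
    by (rule smooth_double_rotation) fact+
  fix p
  let ?D = "frechet_derivative (double_rotation r \<theta> f) (at p)"
  have "times_cont_diff_on 1 UNIV (double_rotation r \<theta> f)"
    using smooth smooth_map_on_def by blast
  then have "linear ?D"
    by (auto intro: linear_frechet_derivative)
  moreover have "v = 0" if "?D v = 0" for v
  proof -
    have "((r' (p $ 1))\<^sup>2 + (r (p $ 1) * \<theta>' (p $ 1))\<^sup>2 + (f' (p $ 1))\<^sup>2) * (v $ 1)\<^sup>2
        + (f (p $ 1))\<^sup>2 * (v $ 2)\<^sup>2 = 0"
      using inner_frechet_derivative_double_rotation[of p v v] that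
      by (simp add: power2_eq_square)
    moreover have "((r' (p $ 1))\<^sup>2 + (r (p $ 1) * \<theta>' (p $ 1))\<^sup>2 + (f' (p $ 1))\<^sup>2) * (v $ 1)\<^sup>2 \<ge> 0"
      using E[of "p $ 1"] by simp
    moreover have "(f (p $ 1))\<^sup>2 * (v $ 2)\<^sup>2 \<ge> 0"
      by simp
    ultimately have "((r' (p $ 1))\<^sup>2 + (r (p $ 1) * \<theta>' (p $ 1))\<^sup>2 + (f' (p $ 1))\<^sup>2) * (v $ 1)\<^sup>2 = 0"
      "(f (p $ 1))\<^sup>2 * (v $ 2)\<^sup>2 = 0"
      by linarith+
    then have "v $ 1 = 0" "v $ 2 = 0"
      using E[of "p $ 1"] f[of "p $ 1"] by auto
    then show ?thesis
      by (simp add: vec_eq_iff forall_2)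
  qed
  ultimately show "inj ?D"
    by (simp add: linear_injective_0)
qed

end

text \<open>Congruence modulo the lattice of translations that is generated by the vectors
  \<open>P\<^sub>i e\<^sub>i\<close>.\<close>
definition period_cong :: "real ^ 'n \<Rightarrow> real ^ 'n \<Rightarrow> real ^ 'n \<Rightarrow> bool" where
  "period_cong P p q \<longleftrightarrow> (\<forall>i. \<exists>k::int. p $ i = q $ i + of_int k * P $ i)"

lemma polar_eq_iff:
  fixes r r' \<alpha> \<beta> :: real
  assumes "r > 0" "r' > 0"
  shows "r * cos \<alpha> = r' * cos \<beta> \<and> r * sin \<alpha> = r' * sin \<beta> \<longleftrightarrow>
    r = r' \<and> (\<exists>k::int. \<alpha> = \<beta> + 2 * pi * of_int k)"
proof
  assume eq: "r * cos \<alpha> = r' * cos \<beta> \<and> r * sin \<alpha> = r' * sin \<beta>"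
  have "r\<^sup>2 = (r * cos \<alpha>)\<^sup>2 + (r * sin \<alpha>)\<^sup>2"
    by (simp add: power_mult_distrib flip: distrib_left)
  also have "\<dots> = (r' * cos \<beta>)\<^sup>2 + (r' * sin \<beta>)\<^sup>2"
    using eq by simp
  also have "\<dots> = r'\<^sup>2"
    by (simp add: power_mult_distrib flip: distrib_left)
  finally have "r = r'"
    using assms by (simp add: power2_eq_iff_nonneg)
  then show "r = r' \<and> (\<exists>k::int. \<alpha> = \<beta> + 2 * pi * of_int k)"
    using eq assms sin_cos_eq_iff[of \<alpha> \<beta>] by simp
next
  assume "r = r' \<and> (\<exists>k::int. \<alpha> = \<beta> + 2 * pi * of_int k)"
  then show "r * cos \<alpha> = r' * cos \<beta> \<and> r * sin \<alpha> = r' * sin \<beta>"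
    using sin_cos_eq_iff[of \<alpha> \<beta>] by simp
qed

lemma add_of_int_period:
  fixes h :: "real \<Rightarrow> real"
  assumes step: "\<And>s. h (s + P) = h s + a"
  shows "h (s + of_int k * P) = h s + of_int k * a"
proof (induction k rule: int_induct[of _ 0])
  case base
  then show ?case by simp
next
  case (step1 i)
  then show ?case
    using assms[of "s + of_int i * P"] by (simp add: algebra_simps)
next
  case (step2 i)
  then show ?case
    using assms[of "s + of_int (i - 1) * P"] by (simp add: algebra_simps)
qed

text \<open>An arbitrary winding number \<open>n\<close> of \<open>\<theta>\<close> per period suffices for invariance; the converse, below,
  needs \<open>n = 1\<close>.\<close>
lemma double_rotation_eqI:
  assumes per: "\<And>s. r (s + P) = r s" "\<And>s. f (s + P) = f s"
    "\<And>s. \<theta> (s + P) = \<theta> s + of_int n * (2 * pi)"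
    and pq: "period_cong (vector [P, 2 * pi]) p q"
  shows "double_rotation r \<theta> f p = double_rotation r \<theta> f q"
proof -
  obtain k j :: int where k: "p $ 1 = q $ 1 + of_int k * P" and j: "p $ 2 = q $ 2 + of_int j * (2 * pi)"
    using pq unfolding period_cong_def forall_2 vector_2 by blast
  have "r (p $ 1) = r (q $ 1)" "f (p $ 1) = f (q $ 1)"
    using add_of_int_period[of r P 0] add_of_int_period[of f P 0] per by (simp_all add: k)
  moreover have "\<theta> (p $ 1) = \<theta> (q $ 1) + 2 * pi * of_int (k * n)"
    using add_of_int_period[of \<theta> P "of_int n * (2 * pi)"] per by (simp add: k)
  then have "sin (\<theta> (p $ 1)) = sin (\<theta> (q $ 1)) \<and> cos (\<theta> (p $ 1)) = cos (\<theta> (q $ 1))"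
    unfolding sin_cos_eq_iff by blast
  moreover have "p $ 2 = q $ 2 + 2 * pi * of_int j"
    by (simp add: j)
  then have "sin (p $ 2) = sin (q $ 2) \<and> cos (p $ 2) = cos (q $ 2)"
    unfolding sin_cos_eq_iff by blast
  ultimately show ?thesis
    by (simp add: double_rotation_def)
qed

text \<open>Equality of the first components makes the two values of \<open>\<theta>\<close> differ by full turns.  Since \<open>\<theta>\<close>
  makes one full turn per period, shifting one argument by as many periods equalizes the values, and
  injectivity of \<open>\<theta>\<close> then identifies the arguments.\<close>
lemma double_rotation_eq_iff:
  assumes pos: "\<And>s. r s > 0" "\<And>s. f s > 0"
    and per: "\<And>s. r (s + P) = r s" "\<And>s. f (s + P) = f s" "\<And>s. \<theta> (s + P) = \<theta> s + 2 * pi"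
    and inj: "inj \<theta>"
  shows "double_rotation r \<theta> f p = double_rotation r \<theta> f q \<longleftrightarrow>
    period_cong (vector [P, 2 * pi]) p q"
proof
  assume "double_rotation r \<theta> f p = double_rotation r \<theta> f q"
  then have "\<exists>k::int. \<theta> (p $ 1) = \<theta> (q $ 1) + 2 * pi * of_int k"
    "\<exists>j::int. p $ 2 = q $ 2 + 2 * pi * of_int j"
    unfolding double_rotation_def vec_eq_iff forall_4 vector_4_nth
    using polar_eq_iff[OF pos(1) pos(1)] polar_eq_iff[OF pos(2) pos(2)] by blast+
  then obtain k j :: int where k: "\<theta> (p $ 1) = \<theta> (q $ 1) + of_int k * (2 * pi)"
    and j: "p $ 2 = q $ 2 + of_int j * (2 * pi)"
    by (auto simp: mult.commute)
  have "\<theta> (p $ 1) = \<theta> (q $ 1 + of_int k * P)"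
    using add_of_int_period[of \<theta> P "2 * pi"] per(3) k by simp
  then have "p $ 1 = q $ 1 + of_int k * P"
    using inj by (rule injD[rotated])
  with j show "period_cong (vector [P, 2 * pi]) p q"
    unfolding period_cong_def forall_2 vector_2 by blast
next
  assume "period_cong (vector [P, 2 * pi]) p q"
  then show "double_rotation r \<theta> f p = double_rotation r \<theta> f q"
    by (rule double_rotation_eqI[where n = 1, rotated -1]) (simp_all add: per)
qed

section \<open>Immersions whose fibres are the orbits of a lattice\<close>
context
  fixes X :: "real^2 \<Rightarrow> 'a::euclidean_space" and P :: "real^2"
  assumes P: "\<And>i. P $ i > 0"
    and X: "smooth_immersion_on UNIV X"
    and fibre: "\<And>p q. X p = X q \<longleftrightarrow> period_cong P p q"
begin

lemma continuous_periodic_immersion: "continuous_on A X"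
proof -
  have "times_cont_diff_on 0 UNIV X"
    using X unfolding smooth_immersion_on_def smooth_map_on_def by blast
  then show ?thesis
    using continuous_on_subset by auto
qed

text \<open>Every point can be moved into the closed period cell centred at \<open>a\<close> by rounding its coordinates
  relative to \<open>a\<close> to the nearest multiple of the period.\<close>
lemma image_period_cell:
  "X ` cbox (a - (1/2) *\<^sub>R P) (a + (1/2) *\<^sub>R P) = range X"
proof -
  have "X p \<in> X ` cbox (a - (1/2) *\<^sub>R P) (a + (1/2) *\<^sub>R P)" for p
  proof -
    define k where "k i = \<lfloor>(p $ i - a $ i) / P $ i + 1/2\<rfloor>" for i
    define q where "q = (\<chi> i. p $ i - of_int (k i) * P $ i)"
    have "a $ i - P $ i / 2 \<le> q $ i \<and> q $ i \<le> a $ i + P $ i / 2" for i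
    proof -
      have "of_int (k i) \<le> (p $ i - a $ i) / P $ i + 1/2"
        "(p $ i - a $ i) / P $ i + 1/2 < of_int (k i) + 1"
        unfolding k_def by linarith+
      then have "of_int (k i) * P $ i \<le> ((p $ i - a $ i) / P $ i + 1/2) * P $ i"
        "((p $ i - a $ i) / P $ i + 1/2) * P $ i < (of_int (k i) + 1) * P $ i"
        using P[of i] by (simp_all only: mult_right_mono less_imp_le mult_strict_right_mono)
      moreover have "((p $ i - a $ i) / P $ i + 1/2) * P $ i = p $ i - a $ i + P $ i / 2"
        using P[of i] by (simp add: field_simps)
      ultimately show ?thesis
        by (simp add: q_def algebra_simps)
    qed
    then have "q \<in> cbox (a - (1/2) *\<^sub>R P) (a + (1/2) *\<^sub>R P)"
      by (simp add: mem_box_cart)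
    moreover have "period_cong P p q"
      by (auto simp: period_cong_def q_def)
    ultimately show ?thesis
      using fibre by blast
  qed
  then show ?thesis by blast
qed

lemma compact_range_periodic_immersion: "compact (range X)"
  using compact_continuous_image[OF continuous_periodic_immersion compact_cbox]
    image_period_cell by metis

text \<open>An interior point of the cell has no other representative in the closed cell, since all
  coordinates of the difference are strictly smaller than the periods.\<close>
lemma fibre_period_cell:
  assumes "X p = X q" "p \<in> box (a - (1/2) *\<^sub>R P) (a + (1/2) *\<^sub>R P)"
    "q \<in> cbox (a - (1/2) *\<^sub>R P) (a + (1/2) *\<^sub>R P)"
  shows "p = q"
proof -
  have "p $ i = q $ i" for i
  proof -
    obtain k :: int where k: "p $ i = q $ i + of_int k * P $ i"
      using assms(1)[unfolded fibre] unfolding period_cong_def by blast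
    have b: "a $ i - P $ i / 2 < p $ i" "p $ i < a $ i + P $ i / 2"
      "a $ i - P $ i / 2 \<le> q $ i" "q $ i \<le> a $ i + P $ i / 2"
      using assms(2,3) by (auto simp: mem_box_cart)
    then have "of_int k * P $ i < 1 * P $ i" "(- 1) * P $ i < of_int k * P $ i"
      using k by linarith+
    then have "of_int k < (1::real)" "(- 1::real) < of_int k"
      using P[of i] mult_less_cancel_right_pos by blast+
    then have "k = 0" by linarith
    then show ?thesis using k by simp
  qed
  then show ?thesis by (simp add: vec_eq_iff)
qed

text \<open>Restricted to an open cell the map is not only injective but also open onto the image of the
  whole plane: the image of an open \<open>W\<close> is the complement of the image of the closed cell without \<open>W\<close>,
  and the latter image is compact.\<close>
lemma local_parametrization_periodic_immersion:
  "local_parametrization (range X) (box (a - (1/2) *\<^sub>R P) (a + (1/2) *\<^sub>R P)) X"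
proof -
  let ?U = "box (a - (1/2) *\<^sub>R P) (a + (1/2) *\<^sub>R P)"
  let ?C = "cbox (a - (1/2) *\<^sub>R P) (a + (1/2) *\<^sub>R P)"
  have UC: "?U \<subseteq> ?C" by (rule box_subset_cbox)
  have inj: "inj_on X ?U"
  proof (rule inj_onI)
    fix p q assume "p \<in> ?U" "q \<in> ?U" "X p = X q"
    then show "p = q"
      using UC by (intro fibre_period_cell) auto
  qed
  have open_image: "openin (top_of_set (range X)) (X ` W)" if "open W" "W \<subseteq> ?U" for W
  proof -
    have "compact (?C - W)"
      using that by (simp add: compact_diff)
    then have "closed (X ` (?C - W))"
      by (intro compact_imp_closed compact_continuous_image continuous_periodic_immersion)
    moreover have "X ` W = range X \<inter> - X ` (?C - W)"
    proof
      show "X ` W \<subseteq> range X \<inter> - X ` (?C - W)"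
      proof
        fix y assume "y \<in> X ` W"
        then obtain p where p: "p \<in> W" "y = X p" by blast
        have "y \<noteq> X q" if "q \<in> ?C - W" for q
        proof
          assume "y = X q"
          then have "p = q"
            using p that \<open>W \<subseteq> ?U\<close> by (intro fibre_period_cell[of p q a]) auto
          then show False
            using p that by simp
        qed
        then show "y \<in> range X \<inter> - X ` (?C - W)"
          using p by auto
      qed
      show "range X \<inter> - X ` (?C - W) \<subseteq> X ` W"
        unfolding image_period_cell[of a, symmetric] by auto
    qed
    ultimately show ?thesis
      by (simp add: openin_open_Int open_Compl)
  qed
  obtain Y where "homeomorphism ?U (X ` ?U) X Y"
  proof (rule homeomorphism_injective_open_map[OF continuous_periodic_immersion refl inj])
    fix W assume "openin (top_of_set ?U) W"
    then have "open W" "W \<subseteq> ?U"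
      by (simp_all add: openin_open_eq[OF open_box])
    then show "openin (top_of_set (X ` ?U)) (X ` W)"
      by (intro openin_subset_trans[OF open_image]) auto
  qed (rule that)
  moreover have "smooth_immersion_on ?U X"
    using X by (rule smooth_immersion_on_subset) simp
  ultimately show ?thesis
    using open_image[OF open_box subset_refl] open_box[of "a - (1/2) *\<^sub>R P"]
    by (auto simp: local_parametrization_def)
qed

lemma centre_mem_period_cell: "a \<in> box (a - (1/2) *\<^sub>R P) (a + (1/2) *\<^sub>R P)"
  using P by (simp add: mem_box_cart)

lemma regular_surface_range_periodic_immersion: "regular_surface (range X)"
  unfolding regular_surface_def
  using local_parametrization_periodic_immersion centre_mem_period_cell by blast

text \<open>In the parametrization by a cell, the descended map is the original one.\<close>
lemma surface_immersion_of_descended_map: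
  assumes "smooth_immersion_on UNIV (F \<circ> X)" "range (F \<circ> X) \<subseteq> N"
  shows "surface_immersion (range X) N F"
  unfolding surface_immersion_def
proof (intro conjI ballI)
  show "F ` range X \<subseteq> N"
    using assms(2) by (simp add: image_comp)
  fix y assume "y \<in> range X"
  then obtain a where a: "y = X a" by blast
  let ?U = "box (a - (1/2) *\<^sub>R P) (a + (1/2) *\<^sub>R P)"
  have "smooth_immersion_on ?U (F \<circ> X)"
    using assms(1) by (rule smooth_immersion_on_subset) simp
  then show "\<exists>U x. local_parametrization (range X) U x \<and> y \<in> x ` U \<and> smooth_immersion_on U (F \<circ> x)"
    using local_parametrization_periodic_immersion[of a] imageI[OF centre_mem_period_cell[of a], of X]
    unfolding a by (intro exI conjI)
qed

end

text \<open>The model \<open>q\<close> serves to realize the quotient of the plane by the lattice as a surface in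
  \<open>\<real>\<^sup>4\<close>, through which any map with the same periods factors.\<close>
lemma image_is_compact_surface_if_periodic:
  fixes q :: "real^2 \<Rightarrow> real^4" and X :: "real^2 \<Rightarrow> 'b::euclidean_space"
  assumes P: "\<And>i. P $ i > 0"
    and q: "smooth_immersion_on UNIV q" "\<And>p p'. q p = q p' \<longleftrightarrow> period_cong P p p'"
    and X: "smooth_immersion_on UNIV X" "range X \<subseteq> N"
    and per: "\<And>p p'. period_cong P p p' \<Longrightarrow> X p = X p'"
  shows "image_is_compact_surface N X"
proof -
  define F where "F = X \<circ> inv q"
  have "X p = F (q p)" for p
  proof -
    have "q p = q (inv q (q p))"
      by (simp add: f_inv_into_f)
    then show ?thesis
      using q(2) per by (auto simp: F_def)
  qed
  then have eq: "X = F \<circ> q"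
    by (simp add: fun_eq_iff)
  show ?thesis
    unfolding image_is_compact_surface_def
    using compact_range_periodic_immersion[OF P q] regular_surface_range_periodic_immersion[OF P q]
      surface_immersion_of_descended_map[OF P q, of F N] X q(1) eq by blast
qed

section \<open>Curvature of warped products over a line\<close>
lemma pderiv_at_of_coordinate:
  assumes "(\<phi> has_real_derivative d) (at (p $ 1))"
  shows "pderiv_at i (\<lambda>q. \<phi> (q $ 1)) p = (if i = 1 then d else 0)"
  using fun_cong[OF frechet_derivative_at[OF has_derivative_of_coordinate[OF assms]], of "axis i 1"]
  by (auto simp: pderiv_at_def axis_def)

lemma pderiv_at_const: "pderiv_at i (\<lambda>q. a) p = 0"
  using pderiv_at_of_coordinate[of "\<lambda>_. a" 0 p i] by simp

lemma matrix_inv_diag_2: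
  fixes a b :: real
  assumes "a \<noteq> 0" "b \<noteq> 0"
  shows "matrix_inv (vector [vector [a, 0], vector [0, b]] :: real^2^2) =
    vector [vector [1 / a, 0], vector [0, 1 / b]]"
    (is "matrix_inv ?A = ?B")
proof -
  have AB: "?A ** ?B = mat 1" "?B ** ?A = mat 1"
    using assms by (simp_all add: matrix_matrix_mult_def vec_eq_iff forall_2 sum_2 mat_def)
  then have "invertible ?A"
    unfolding invertible_def by blast
  then have "matrix_inv ?A ** ?A = mat 1"
    unfolding invertible_def matrix_inv_def by (rule someI2_ex) blast
  then have "(matrix_inv ?A ** ?A) ** ?B = ?B"
    by simp
  then show ?thesis
    by (simp only: matrix_mul_assoc[symmetric] AB(1) matrix_mul_rid)
qed

text \<open>The metric \<open>ds\<^sup>2 + h(s) dt\<^sup>2\<close>.  The warping enters through its square \<open>h\<close>, which for the surfaces in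
  question satisfies simpler equations than its root.\<close>
definition warped_product :: "(real \<Rightarrow> real) \<Rightarrow> real^2 \<Rightarrow> real^2^2" where
  "warped_product h p = vector [vector [1, 0], vector [0, h (p $ 1)]]"

context
  fixes h h' h'' :: "real \<Rightarrow> real"
  assumes h: "\<And>s. h s > 0"
    and h': "\<And>s. (h has_real_derivative h' s) (at s)"
    and h'': "\<And>s. (h' has_real_derivative h'' s) (at s)"
begin

lemma warped_product_nth [simp]:
  "warped_product h p $ 1 $ 1 = 1" "warped_product h p $ 1 $ 2 = 0"
  "warped_product h p $ 2 $ 1 = 0" "warped_product h p $ 2 $ 2 = h (p $ 1)"
  by (simp_all add: warped_product_def)

lemma matrix_inv_warped_product [simp]:
  "matrix_inv (warped_product h p) $ 1 $ 1 = 1" "matrix_inv (warped_product h p) $ 1 $ 2 = 0"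
  "matrix_inv (warped_product h p) $ 2 $ 1 = 0" "matrix_inv (warped_product h p) $ 2 $ 2 = 1 / h (p $ 1)"
  using matrix_inv_diag_2[of 1 "h (p $ 1)"] h[of "p $ 1"] by (simp_all add: warped_product_def)

lemma det_warped_product [simp]: "det (warped_product h p) = h (p $ 1)"
  by (simp add: det_2)

lemma pderiv_h [simp]:
  "pderiv_at 1 (\<lambda>q. h (q $ 1)) p = h' (p $ 1)" "pderiv_at 2 (\<lambda>q. h (q $ 1)) p = 0"
  by (simp_all add: pderiv_at_of_coordinate[OF h'])

lemma christoffel_warped_product:
  "christoffel (warped_product h) 1 1 1 = (\<lambda>p. 0)"
  "christoffel (warped_product h) 1 1 2 = (\<lambda>p. 0)"
  "christoffel (warped_product h) 1 2 1 = (\<lambda>p. 0)"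
  "christoffel (warped_product h) 2 1 1 = (\<lambda>p. 0)"
  "christoffel (warped_product h) 2 2 2 = (\<lambda>p. 0)"
  "christoffel (warped_product h) 1 2 2 = (\<lambda>p. - h' (p $ 1) / 2)"
  "christoffel (warped_product h) 2 1 2 = (\<lambda>p. h' (p $ 1) / h (p $ 1) / 2)"
  "christoffel (warped_product h) 2 2 1 = (\<lambda>p. h' (p $ 1) / h (p $ 1) / 2)"
  by (simp_all add: fun_eq_iff christoffel_def sum_2 pderiv_at_const)

lemma gauss_curvature_warped_product:
  "gauss_curvature (warped_product h) p =
     (h' (p $ 1))\<^sup>2 / (4 * (h (p $ 1))\<^sup>2) - h'' (p $ 1) / (2 * h (p $ 1))"
proof -
  have "((\<lambda>s. - h' s / 2) has_real_derivative - h'' (p $ 1) / 2) (at (p $ 1))"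
    by (auto intro!: derivative_eq_intros h'')
  from pderiv_at_of_coordinate[OF this]
  have D: "pderiv_at 1 (\<lambda>q. - h' (q $ 1) / 2) p = - h'' (p $ 1) / 2"
    by simp
  have "gauss_curvature (warped_product h) p =
      (pderiv_at 1 (\<lambda>q. - h' (q $ 1) / 2) p + (h' (p $ 1))\<^sup>2 / (4 * h (p $ 1))) / h (p $ 1)"
    by (simp add: gauss_curvature_def curvature_coeff_def sum_2 christoffel_warped_product
        pderiv_at_const power2_eq_square)
  then show ?thesis
    unfolding D using h[of "p $ 1"] by (simp add: field_simps power2_eq_square)
qed

context
  fixes k k' k'' :: "real \<Rightarrow> real"
  assumes k': "\<And>s. (k has_real_derivative k' s) (at s)"
    and k'': "\<And>s. (k' has_real_derivative k'' s) (at s)"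
begin

lemma metric_gradient_warped_product:
  "metric_gradient (warped_product h) (\<lambda>q. k (q $ 1)) p = vector [k' (p $ 1), 0]"
  by (simp add: metric_gradient_def matrix_vector_mult_def vec_eq_iff forall_2 sum_2
      pderiv_at_of_coordinate[OF k'])

lemma metric_norm_sq_gradient_warped_product:
  "metric_norm_sq (warped_product h) p (metric_gradient (warped_product h) (\<lambda>q. k (q $ 1)) p) =
     (k' (p $ 1))\<^sup>2"
  by (simp add: metric_norm_sq_def metric_gradient_warped_product inner_vec_def sum_2
      matrix_vector_mult_def power2_eq_square)

lemma laplace_beltrami_warped_product:
  "laplace_beltrami (warped_product h) (\<lambda>q. k (q $ 1)) p =
     k'' (p $ 1) + h' (p $ 1) * k' (p $ 1) / (2 * h (p $ 1))"
proof -
  let ?s = "p $ 1"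
  have "((\<lambda>s. sqrt (h s) * k' s) has_real_derivative
      h' ?s / (2 * sqrt (h ?s)) * k' ?s + sqrt (h ?s) * k'' ?s) (at ?s)"
    using h[of ?s] by (auto intro!: derivative_eq_intros h' k'' simp: field_simps)
  from pderiv_at_of_coordinate[OF this]
  have D: "pderiv_at 1 (\<lambda>q. sqrt (h (q $ 1)) * k' (q $ 1)) p =
      h' ?s / (2 * sqrt (h ?s)) * k' ?s + sqrt (h ?s) * k'' ?s"
    by simp
  have "laplace_beltrami (warped_product h) (\<lambda>q. k (q $ 1)) p =
      pderiv_at 1 (\<lambda>q. sqrt (h (q $ 1)) * k' (q $ 1)) p / sqrt (h ?s)"
    by (simp add: laplace_beltrami_def metric_gradient_warped_product sum_2 pderiv_at_const)
  moreover have "sqrt (h ?s) * sqrt (h ?s) = h ?s" "sqrt (h ?s) \<noteq> 0"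
    using h[of ?s] by simp_all
  ultimately show ?thesis
    unfolding D using h[of ?s] by (simp add: field_simps)
qed

end

lemma riemannian_metric_warped_product:
  assumes "smooth_map_on UNIV h"
  shows "riemannian_metric (warped_product h)"
  unfolding riemannian_metric_def
proof (intro conjI allI impI)
  have entry: "smooth_map_on UNIV (\<lambda>p. warped_product h p $ i $ j)" for i j
  proof -
    have "i = 1 \<or> i = 2" "j = 1 \<or> j = 2"
      by (rule exhaust_2)+
    then show ?thesis
      by (auto simp: smooth_const smooth_compose_linear[OF bounded_linear_vec_nth assms])
  qed
  show "smooth_map_on UNIV (warped_product h)"
    by (intro smooth_componentwise entry)
  show "transpose (warped_product h p) = warped_product h p" for p
    by (simp add: vec_eq_iff forall_2 transpose_def)
  show "v \<bullet> (warped_product h p *v v) > 0" if "v \<noteq> 0" for p v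
  proof -
    have "v \<bullet> (warped_product h p *v v) = (v $ 1)\<^sup>2 + h (p $ 1) * (v $ 2)\<^sup>2"
      by (simp add: inner_vec_def sum_2 matrix_vector_mult_def power2_eq_square)
    moreover have "v $ 1 \<noteq> 0 \<or> v $ 2 \<noteq> 0"
      using that by (simp add: vec_eq_iff forall_2)
    ultimately show ?thesis
      using h[of "p $ 1"] by (auto intro: add_pos_nonneg add_nonneg_pos)
  qed
qed

text \<open>The first-order equation determines \<open>K = c - m / h\<^sup>2\<close> together with the second-order one, which is its
  derivative divided by \<open>2 h'\<close> but has to be assumed at the zeros of \<open>h'\<close>.  Inserting \<open>K\<close>, the left-hand
  side of the Ricci equation becomes
  \<open>m\<^sup>2 (h'\<^sup>2 - 2 h h'' - 4 (c h\<^sup>2 - m)) / h\<^sup>6\<close>, and the two equations make the bracket vanish.\<close>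
lemma spherical_ricci_surface_warped:
  assumes "smooth_map_on UNIV h"
    and first_integral: "\<And>s. (h' s)\<^sup>2 = 4 * (2 * l * h s - c * (h s)\<^sup>2 - m)"
    and ode: "\<And>s. h'' s = 4 * (l - c * h s)"
  shows "spherical_ricci_surface c (warped_product h)"
proof -
  have hnz: "h s \<noteq> 0" for s
    using h[of s] by simp
  define k where "k s = c - m / (h s)\<^sup>2" for s
  define k' where "k' s = 2 * m * h' s / (h s) ^ 3" for s
  define k'' where "k'' s = 2 * m * h'' s / (h s) ^ 3 - 6 * m * (h' s)\<^sup>2 / (h s) ^ 4" for s
  have k': "(k has_real_derivative k' s) (at s)" for s
    unfolding k_def[abs_def] k'_def
    by (auto intro!: derivative_eq_intros h' simp: hnz field_simps eval_nat_numeral)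
  have k'': "(k' has_real_derivative k'' s) (at s)" for s
    unfolding k'_def[abs_def] k''_def
    by (auto intro!: derivative_eq_intros h' h'' simp: hnz field_simps eval_nat_numeral)
  have K: "gauss_curvature (warped_product h) = (\<lambda>p. k (p $ 1))"
  proof
    fix p
    show "gauss_curvature (warped_product h) p = k (p $ 1)"
      unfolding gauss_curvature_warped_product first_integral ode k_def
      using hnz[of "p $ 1"] by (simp add: field_simps power2_eq_square)
  qed
  have "(k s - c) * (k'' s + h' s * k' s / (2 * h s)) - (k' s)\<^sup>2 - 4 * k s * (k s - c)\<^sup>2 = 0" for s
  proof -
    have "(k s - c) * (k'' s + h' s * k' s / (2 * h s)) - (k' s)\<^sup>2 - 4 * k s * (k s - c)\<^sup>2 =
        m\<^sup>2 * ((h' s)\<^sup>2 - 2 * h s * h'' s - 4 * (c * (h s)\<^sup>2 - m)) / (h s) ^ 6"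
      using hnz[of s] unfolding k_def k'_def k''_def
      by (simp add: field_simps eval_nat_numeral)
    also have "\<dots> = 0"
      unfolding first_integral ode by (simp add: algebra_simps power2_eq_square)
    finally show ?thesis .
  qed
  then show ?thesis
    using riemannian_metric_warped_product[OF assms(1)]
    by (simp add: spherical_ricci_surface_def K laplace_beltrami_warped_product[OF k' k'']
        metric_norm_sq_gradient_warped_product[OF k' k''])
qed

end

section \<open>The profile and the angle function\<close>
definition profile_sq :: "real \<Rightarrow> real \<Rightarrow> real \<Rightarrow> real \<Rightarrow> real" where
  "profile_sq c m l s = (l + sqrt (l\<^sup>2 - c * m) * sin (2 * sqrt c * s)) / c"

definition profile_sq_deriv :: "real \<Rightarrow> real \<Rightarrow> real \<Rightarrow> real \<Rightarrow> real" where
  "profile_sq_deriv c m l s = 2 * sqrt (l\<^sup>2 - c * m) * cos (2 * sqrt c * s) / sqrt c"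

definition angle_deriv :: "real \<Rightarrow> real \<Rightarrow> real \<Rightarrow> real \<Rightarrow> real" where
  "angle_deriv c m l s = sqrt c * (sqrt (m + (1 - 2 * l) * profile_sq c m l s)
     / (profile c m l s * (1 - c * profile_sq c m l s)))"

text \<open>The polar radius that goes with the polar angle \<^const>\<open>angle\<close>: both describe the projection of
  the profile curve to the plane fixed by the rotations.\<close>
definition first_radius :: "real \<Rightarrow> real \<Rightarrow> real \<Rightarrow> real \<Rightarrow> real" where
  "first_radius c m l s = 1 / sqrt c * sqrt (1 - c * profile_sq c m l s)"

context
  fixes c m l :: real
  assumes c: "c > 0" and ml: "(m, l) \<in> Lambda' c"
begin

text \<open>The last bound is the condition \<open>2 l < c m + 1\<close> in disguise, since
  \<open>(1 - l)\<^sup>2 - (l\<^sup>2 - c m) = 1 - 2 l + c m\<close>.\<close>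
lemma parameter_bounds:
  "0 < m" "c * m < l\<^sup>2" "0 < l" "sqrt (l\<^sup>2 - c * m) < l" "l + sqrt (l\<^sup>2 - c * m) < 1"
proof -
  have m: "0 < m" "m < 1 / c" "sqrt (c * m) < l" "2 * l < c * m + 1"
    using ml by (auto simp: Lambda'_def)
  show "0 < m" by fact
  have cm: "0 < c * m" "c * m < 1"
    using m c by (simp_all add: field_simps)
  have "0 \<le> sqrt (c * m)" using cm by simp
  then show l: "0 < l" using m by linarith
  show lt: "c * m < l\<^sup>2"
  proof -
    have "sqrt (c * m) < sqrt (l\<^sup>2)"
      using m(3) l by simp
    then show ?thesis
      by (simp only: real_sqrt_less_iff)
  qed
  have "sqrt (l\<^sup>2 - c * m) < sqrt (l\<^sup>2)"
    using cm by (intro real_sqrt_less_mono) simp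
  then show "sqrt (l\<^sup>2 - c * m) < l"
    using l by simp
  have "sqrt (l\<^sup>2 - c * m) < sqrt ((1 - l)\<^sup>2)"
    using m by (intro real_sqrt_less_mono) (simp add: power2_eq_square algebra_simps)
  then show "l + sqrt (l\<^sup>2 - c * m) < 1"
    using m cm by simp
qed

lemma profile_sq_bounds:
  "l - sqrt (l\<^sup>2 - c * m) \<le> c * profile_sq c m l s" "c * profile_sq c m l s \<le> l + sqrt (l\<^sup>2 - c * m)"
proof -
  have A: "0 \<le> sqrt (l\<^sup>2 - c * m)"
    using parameter_bounds by simp
  have "c * profile_sq c m l s = l + sqrt (l\<^sup>2 - c * m) * sin (2 * sqrt c * s)"
    using c by (simp add: profile_sq_def)
  moreover have "sqrt (l\<^sup>2 - c * m) * sin (2 * sqrt c * s) \<le> sqrt (l\<^sup>2 - c * m) * 1"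
    "sqrt (l\<^sup>2 - c * m) * (- 1) \<le> sqrt (l\<^sup>2 - c * m) * sin (2 * sqrt c * s)"
    using A by (intro mult_left_mono; simp)+
  ultimately show "l - sqrt (l\<^sup>2 - c * m) \<le> c * profile_sq c m l s"
      "c * profile_sq c m l s \<le> l + sqrt (l\<^sup>2 - c * m)"
    by simp_all
qed

lemma profile_sq_pos: "profile_sq c m l s > 0"
proof -
  have "0 < c * profile_sq c m l s"
    using profile_sq_bounds(1)[of s] parameter_bounds(4) by linarith
  then show ?thesis
    using c zero_less_mult_pos by blast
qed

lemma profile_sq_lt: "1 - c * profile_sq c m l s > 0"
  using profile_sq_bounds(2)[of s] parameter_bounds(5) by linarith

text \<open>Only \<open>l > 1/2\<close> is delicate.  The expression is then decreasing in \<open>c h\<close>, and at the maximum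
  \<open>c h = l + A\<close> it equals, up to the factor \<open>1 / c\<close>, the product \<open>(l + A) (1 - l - A) > 0\<close>, because
  \<open>c m = (l - A) (l + A)\<close>.\<close>
lemma radicand_pos: "m + (1 - 2 * l) * profile_sq c m l s > 0"
proof -
  define A where "A = sqrt (l\<^sup>2 - c * m)"
  define x where "x = c * profile_sq c m l s"
  have cm: "c * m = (l - A) * (l + A)"
    using parameter_bounds(2) by (simp add: A_def algebra_simps power2_eq_square[symmetric])
  have x: "l - A \<le> x" "x \<le> l + A" and A: "A < l" "l + A < 1" "0 < l" "0 \<le> A"
    using profile_sq_bounds[of s] parameter_bounds by (simp_all add: A_def x_def)
  have "0 < c * m + (1 - 2 * l) * x"
  proof (cases "1 - 2 * l \<ge> 0")
    case True
    then have "0 \<le> (1 - 2 * l) * x"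
      using x A by simp
    then show ?thesis
      using c parameter_bounds(1) by (simp add: add_pos_nonneg)
  next
    case False
    then have "(2 * l - 1) * x \<le> (2 * l - 1) * (l + A)"
      using x(2) by (intro mult_left_mono) auto
    also have "\<dots> < (l - A) * (l + A)"
      using A by (intro mult_strict_right_mono) auto
    finally show ?thesis
      by (simp add: cm algebra_simps)
  qed
  also have "\<dots> = c * (m + (1 - 2 * l) * profile_sq c m l s)"
    by (simp add: x_def algebra_simps)
  finally show ?thesis
    using c zero_less_mult_pos by blast
qed

lemma profile_eq: "profile c m l s = sqrt (profile_sq c m l s)"
  by (simp add: profile_def profile_sq_def)

lemma profile_pos: "profile c m l s > 0"
  by (simp add: profile_eq profile_sq_pos)

lemma profile_power2: "(profile c m l s)\<^sup>2 = profile_sq c m l s"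
  using profile_sq_pos[of s] by (simp add: profile_eq)

lemma first_radius_pos: "first_radius c m l s > 0"
  using c profile_sq_lt by (simp add: first_radius_def)

lemma first_radius_power2: "(first_radius c m l s)\<^sup>2 = (1 - c * profile_sq c m l s) / c"
  using c profile_sq_lt[of s] by (simp add: first_radius_def power_mult_distrib power_divide)

lemma angle_deriv_pos: "angle_deriv c m l s > 0"
  using c radicand_pos profile_pos profile_sq_lt by (simp add: angle_deriv_def)

lemma has_derivative_profile_sq:
  "(profile_sq c m l has_real_derivative profile_sq_deriv c m l s) (at s)"
proof -
  have "sqrt c * sqrt c = c" "sqrt c > 0"
    using c by simp_all
  then show ?thesis
    unfolding profile_sq_def[abs_def] profile_sq_deriv_def
    using c by (auto intro!: derivative_eq_intros simp: field_simps)
qed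

lemma has_derivative_profile_sq_deriv:
  "(profile_sq_deriv c m l has_real_derivative 4 * (l - c * profile_sq c m l s)) (at s)"
proof -
  define A where "A = sqrt (l\<^sup>2 - c * m)"
  have "((\<lambda>s. 2 * A * cos (2 * sqrt c * s) / sqrt c) has_real_derivative
      2 * A * (- sin (2 * sqrt c * s) * (2 * sqrt c)) / sqrt c) (at s)"
    using c by (intro DERIV_cdivide DERIV_cmult DERIV_chain2[OF DERIV_cos] DERIV_cmult_Id)
  moreover have "2 * A * (- sin (2 * sqrt c * s) * (2 * sqrt c)) / sqrt c =
      4 * (l - c * ((l + A * sin (2 * sqrt c * s)) / c))"
    using c by simp
  ultimately show ?thesis
    unfolding profile_sq_deriv_def[abs_def] profile_sq_def A_def by simp
qed

text \<open>This expresses \<open>sin\<^sup>2 + cos\<^sup>2 = 1\<close> in terms of \<open>h\<close> and \<open>h'\<close>.\<close>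
lemma profile_sq_first_integral:
  "(profile_sq_deriv c m l s)\<^sup>2 = 4 * (2 * l * profile_sq c m l s - c * (profile_sq c m l s)\<^sup>2 - m)"
proof -
  define A where "A = sqrt (l\<^sup>2 - c * m)"
  define x where "x = 2 * sqrt c * s"
  have "A\<^sup>2 = l\<^sup>2 - c * m"
    using parameter_bounds(2) by (simp add: A_def)
  then have m: "m = (l\<^sup>2 - A\<^sup>2) / c"
    using c by (simp add: field_simps)
  have "(profile_sq_deriv c m l s)\<^sup>2 = 4 * A\<^sup>2 * (1 - (sin x)\<^sup>2) / c"
    using c by (simp add: profile_sq_deriv_def A_def[symmetric] x_def[symmetric] power_mult_distrib
        power_divide cos_squared_eq)
  also have "\<dots> = 4 * (2 * l * ((l + A * sin x) / c) - c * ((l + A * sin x) / c)\<^sup>2 - m)"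
    unfolding m using c by (simp add: field_simps power2_eq_square)
  finally show ?thesis
    by (simp add: profile_sq_def A_def x_def)
qed

lemma smooth_profile_sq: "smooth_map_on UNIV (profile_sq c m l)"
  unfolding profile_sq_def[abs_def]
  by (intro smooth_divide smooth_add smooth_mult smooth_sin smooth_const
      smooth_linear[OF bounded_linear_ident]) (use c in auto)

lemma smooth_profile: "smooth_map_on UNIV (profile c m l)"
  using smooth_sqrt[OF smooth_profile_sq profile_sq_pos] by (simp add: profile_eq[abs_def])

lemma smooth_first_radius: "smooth_map_on UNIV (first_radius c m l)"
  unfolding first_radius_def[abs_def]
  by (intro smooth_sqrt smooth_mult smooth_diff smooth_const smooth_profile_sq profile_sq_lt)

lemma smooth_angle_deriv: "smooth_map_on UNIV (angle_deriv c m l)"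
  unfolding angle_deriv_def[abs_def]
proof (intro smooth_divide smooth_sqrt smooth_add smooth_mult smooth_diff smooth_const
      smooth_profile_sq smooth_profile radicand_pos)
  show "profile c m l s * (1 - c * profile_sq c m l s) \<noteq> 0" for s
    using profile_pos[of s] profile_sq_lt[of s] by simp
qed (use c in simp)

lemma has_derivative_profile:
  "(profile c m l has_real_derivative
     profile_sq_deriv c m l s / (2 * profile c m l s)) (at s)"
proof -
  have "((\<lambda>s. sqrt (profile_sq c m l s)) has_real_derivative
      inverse (sqrt (profile_sq c m l s)) / 2 * profile_sq_deriv c m l s) (at s)"
    by (rule DERIV_chain2[OF DERIV_real_sqrt[OF profile_sq_pos[of s]] has_derivative_profile_sq])
  then show ?thesis
    unfolding profile_eq[abs_def] by (rule DERIV_cong) (simp add: divide_simps)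
qed

lemma has_derivative_first_radius:
  "(first_radius c m l has_real_derivative
     - (profile_sq_deriv c m l s / (2 * first_radius c m l s))) (at s)"
proof -
  have "((\<lambda>s. 1 - c * profile_sq c m l s) has_real_derivative - c * profile_sq_deriv c m l s) (at s)"
    by (auto intro!: derivative_eq_intros has_derivative_profile_sq)
  from DERIV_cmult[OF DERIV_chain2[OF DERIV_real_sqrt[OF profile_sq_lt[of s]] this], of "1 / sqrt c"]
  have "(first_radius c m l has_real_derivative
    1 / sqrt c * (inverse (sqrt (1 - c * profile_sq c m l s)) / 2 * (- c * profile_sq_deriv c m l s))) (at s)"
    by (simp only: first_radius_def[abs_def])
  moreover have "sqrt c * sqrt c = c" "sqrt c > 0" "sqrt (1 - c * profile_sq c m l s) > 0"
    using c profile_sq_lt[of s] by simp_all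
  ultimately show ?thesis
    unfolding first_radius_def[of c m l s] by (elim DERIV_cong) (simp add: field_simps)
qed

lemma angle_eq: "angle c m l s = (LBINT r=ereal 0..ereal s. angle_deriv c m l r)"
  by (simp only: angle_def angle_deriv_def profile_power2 interval_lebesgue_integral_mult_right
      zero_ereal_def[symmetric])

lemma angle_0: "angle c m l 0 = 0"
  by (simp add: angle_eq)

lemma has_derivative_angle: "(angle c m l has_real_derivative angle_deriv c m l s) (at s)"
proof -
  \<comment> \<open>The fundamental theorem of calculus applies on a compact interval; this one contains both the
    base point \<open>0\<close> and, in its interior, the point \<open>s\<close>.\<close>
  define a where "a = - \<bar>s\<bar> - 1"
  define b where "b = \<bar>s\<bar> + 1"
  have "times_cont_diff_on 0 UNIV (angle_deriv c m l)"
    using smooth_angle_deriv unfolding smooth_map_on_def by blast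
  then have "continuous_on {a..b} (angle_deriv c m l)"
    using continuous_on_subset by auto
  then have "((\<lambda>u. LBINT r=ereal 0..ereal u. angle_deriv c m l r) has_vector_derivative angle_deriv c m l s)
      (at s within {a..b})"
    by (intro interval_integral_FTC2) (auto simp: a_def b_def)
  moreover have "s \<in> interior {a..b}"
    by (simp add: a_def b_def abs_if)
  ultimately have "(angle c m l has_vector_derivative angle_deriv c m l s) (at s)"
    by (simp only: at_within_interior angle_eq[abs_def])
  then show ?thesis
    by (simp only: has_real_derivative_iff_has_vector_derivative)
qed

lemma smooth_angle: "smooth_map_on UNIV (angle c m l)"
  using has_derivative_angle smooth_angle_deriv by (rule smooth_antiderivative)

lemma strict_mono_angle: "strict_mono (angle c m l)"
proof (rule strict_monoI)
  fix a b :: real assume "a < b"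
  then show "angle c m l a < angle c m l b"
    by (rule DERIV_pos_imp_increasing) (rule exI conjI has_derivative_angle angle_deriv_pos)+
qed

lemma profile_sq_periodic: "profile_sq c m l (s + pi / sqrt c) = profile_sq c m l s"
proof -
  have "2 * sqrt c * (s + pi / sqrt c) = 2 * sqrt c * s + 2 * pi"
    using c by (simp add: field_simps)
  then show ?thesis
    by (simp add: profile_sq_def)
qed

lemma profile_periodic: "profile c m l (s + pi / sqrt c) = profile c m l s"
  by (simp add: profile_eq profile_sq_periodic)

lemma first_radius_periodic: "first_radius c m l (s + pi / sqrt c) = first_radius c m l s"
  by (simp add: first_radius_def profile_sq_periodic)

text \<open>The integrand has the period of the profile, so the increment of the angle over one period does
  not depend on where the period starts.\<close>
lemma angle_quasi_periodic:
  "angle c m l (s + pi / sqrt c) = angle c m l s + angle c m l (pi / sqrt c)"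
proof -
  let ?T = "pi / sqrt c"
  have "((\<lambda>s. angle c m l (s + ?T) - angle c m l s) has_real_derivative 0) (at s)" for s
  proof -
    have "angle_deriv c m l (s + ?T) = angle_deriv c m l s"
      by (simp add: angle_deriv_def profile_periodic profile_sq_periodic)
    then show ?thesis
      using DERIV_diff[OF DERIV_shift[THEN iffD1, OF has_derivative_angle[of "s + ?T"]]
          has_derivative_angle[of s]] by simp
  qed
  then have "angle c m l (s + ?T) - angle c m l s = angle c m l (0 + ?T) - angle c m l 0"
    by (intro DERIV_isconst_all) auto
  then show ?thesis
    by (simp add: angle_0)
qed

lemma angle_period_pos: "angle c m l (pi / sqrt c) > 0"
  using strict_monoD[OF strict_mono_angle, of 0 "pi / sqrt c"] c by (simp add: angle_0)

section \<open>The rotational surfaces\<close>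
lemma rotational_surface_eq:
  "rotational_surface c m l = double_rotation (first_radius c m l) (angle c m l) (profile c m l)"
proof
  fix p
  show "rotational_surface c m l p =
      double_rotation (first_radius c m l) (angle c m l) (profile c m l) p"
    unfolding rotational_surface_def rotation_def profile_curve_def vector_4_nth double_rotation_def
      first_radius_def profile_power2 by simp
qed

text \<open>With \<open>N = h'\<^sup>2 / 4\<close> and \<open>y = 1 - c h\<close>, the two radial terms are \<open>c N / y\<close> and \<open>N / h\<close>; they add up to
  \<open>N / (h y)\<close>, because \<open>c h + y = 1\<close>.  The angular term is what is missing to \<open>1\<close>.\<close>
lemma profile_curve_unit_speed:
  "(- (profile_sq_deriv c m l s / (2 * first_radius c m l s)))\<^sup>2
    + (first_radius c m l s * angle_deriv c m l s)\<^sup>2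
    + (profile_sq_deriv c m l s / (2 * profile c m l s))\<^sup>2 = 1"
proof -
  define h where "h = profile_sq c m l s"
  define y where "y = 1 - c * h"
  define N where "N = 2 * l * h - c * h\<^sup>2 - m"
  have h: "h > 0" and y: "y > 0"
    using profile_sq_pos profile_sq_lt by (simp_all add: h_def y_def)
  have d: "(profile_sq_deriv c m l s)\<^sup>2 = 4 * N"
    by (simp add: profile_sq_first_integral N_def h_def)
  have ax: "(first_radius c m l s)\<^sup>2 = y / c"
    by (simp add: first_radius_power2 y_def h_def)
  have ang: "(angle_deriv c m l s)\<^sup>2 = c * ((m + (1 - 2 * l) * h) / (h * y\<^sup>2))"
    using c radicand_pos[of s]
    by (simp add: angle_deriv_def power_mult_distrib power_divide profile_power2 h_def y_def)
  have "(- (profile_sq_deriv c m l s / (2 * first_radius c m l s)))\<^sup>2 = N * (c / y)"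
    by (simp add: power_mult_distrib power_divide ax d)
  moreover have "(first_radius c m l s * angle_deriv c m l s)\<^sup>2 = (m + (1 - 2 * l) * h) / (h * y)"
    unfolding power_mult_distrib ax ang using c h y by (simp add: field_simps power2_eq_square)
  moreover have "(profile_sq_deriv c m l s / (2 * profile c m l s))\<^sup>2 = N / h"
    by (simp add: power_mult_distrib power_divide profile_power2 d h_def[symmetric])
  moreover have "N * (c / y) + (m + (1 - 2 * l) * h) / (h * y) + N / h =
      (N * (c * h + y) + (m + (1 - 2 * l) * h)) / (h * y)"
    using h y by (simp add: field_simps)
  moreover have "N * (c * h + y) + (m + (1 - 2 * l) * h) = h * y"
    by (simp add: N_def y_def algebra_simps power2_eq_square)
  ultimately show ?thesis
    using h y by simp
qed

lemma warped_metric_eq: "warped_metric c m l = warped_product (profile_sq c m l)"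
  by (simp add: fun_eq_iff warped_metric_def warped_product_def profile_power2)

lemma spherical_ricci_surface_warped_metric: "spherical_ricci_surface c (warped_metric c m l)"
  unfolding warped_metric_eq
  by (rule spherical_ricci_surface_warped[OF profile_sq_pos has_derivative_profile_sq
        has_derivative_profile_sq_deriv smooth_profile_sq profile_sq_first_integral refl])

lemma smooth_immersion_rotational_surface: "smooth_immersion_on UNIV (rotational_surface c m l)"
  unfolding rotational_surface_eq
proof (rule smooth_immersion_double_rotation[OF has_derivative_first_radius has_derivative_angle
      has_derivative_profile smooth_first_radius smooth_angle smooth_profile])
  show "profile c m l s \<noteq> 0" for s
    using profile_pos[of s] by simp
  show "(- (profile_sq_deriv c m l s / (2 * first_radius c m l s)))\<^sup>2
      + (first_radius c m l s * angle_deriv c m l s)\<^sup>2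
      + (profile_sq_deriv c m l s / (2 * profile c m l s))\<^sup>2 > 0" for s
    unfolding profile_curve_unit_speed by simp
qed

lemma range_rotational_surface: "range (rotational_surface c m l) \<subseteq> S3 c"
proof -
  have "rotational_surface c m l p \<in> S3 c" for p
  proof -
    have polar: "(r * cos a)\<^sup>2 + (r * sin a)\<^sup>2 = r\<^sup>2" for r a :: real
      by (simp add: power_mult_distrib flip: distrib_left)
    have "(first_radius c m l (p $ 1))\<^sup>2 + (profile c m l (p $ 1))\<^sup>2 = 1 / c"
      using c by (simp add: first_radius_power2 profile_power2 diff_divide_distrib)
    then show ?thesis
      using polar[of "first_radius c m l (p $ 1)" "angle c m l (p $ 1)"]
        polar[of "profile c m l (p $ 1)" "p $ 2"]
      unfolding S3_def rotational_surface_eq double_rotation_def mem_Collect_eq vector_4_nth by linarith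
  qed
  then show ?thesis by blast
qed

lemma isometric_immersion_rotational_surface:
  "isometric_immersion (warped_metric c m l) (S3 c) (rotational_surface c m l)"
  unfolding isometric_immersion_def
proof (intro conjI allI range_rotational_surface smooth_immersion_rotational_surface)
  fix p u v
  have "u \<bullet> (warped_metric c m l p *v v) = u $ 1 * v $ 1 + profile_sq c m l (p $ 1) * (u $ 2 * v $ 2)"
    by (simp add: inner_vec_def sum_2 matrix_vector_mult_def warped_metric_def profile_power2)
  then show "frechet_derivative (rotational_surface c m l) (at p) u \<bullet>
      frechet_derivative (rotational_surface c m l) (at p) v = u \<bullet> (warped_metric c m l p *v v)"
    unfolding rotational_surface_eq inner_frechet_derivative_double_rotation[OF
        has_derivative_first_radius has_derivative_angle has_derivative_profile] profile_curve_unit_speed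
    by (simp add: profile_power2)
qed

lemma angle_multiple_period:
  "angle c m l (s + real b * (pi / sqrt c)) = angle c m l s + real b * angle c m l (pi / sqrt c)"
  using add_of_int_period[of "angle c m l" "pi / sqrt c" "angle c m l (pi / sqrt c)" s "int b",
      OF angle_quasi_periodic]
  by simp

lemma radii_multiple_period:
  "first_radius c m l (s + real b * (pi / sqrt c)) = first_radius c m l s"
  "profile c m l (s + real b * (pi / sqrt c)) = profile c m l s"
proof -
  have "first_radius c m l (t + pi / sqrt c) = first_radius c m l t + 0" for t
    by (simp add: first_radius_periodic)
  from add_of_int_period[of "first_radius c m l", OF this, of s "int b"]
  show "first_radius c m l (s + real b * (pi / sqrt c)) = first_radius c m l s"
    by simp
  have "profile c m l (t + pi / sqrt c) = profile c m l t + 0" for t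
    by (simp add: profile_periodic)
  from add_of_int_period[of "profile c m l", OF this, of s "int b"]
  show "profile c m l (s + real b * (pi / sqrt c)) = profile c m l s"
    by simp
qed

text \<open>If \<open>\<theta>(T) = 2 pi a / b\<close>, the surface closes up after \<open>b\<close> periods of the profile, during which it
  winds \<open>a\<close> times around.  The model of the quotient is the standard torus, traversed with the same
  periods but winding only once.\<close>
lemma compact_surface_if_rational:
  assumes "angle c m l (pi / sqrt c) / (2 * pi) \<in> \<rat>"
  shows "image_is_compact_surface (S3 c) (rotational_surface c m l)"
proof -
  obtain a b :: nat where b: "b \<noteq> 0" and ab: "\<bar>angle c m l (pi / sqrt c) / (2 * pi)\<bar> = real a / real b"
    using assms by (rule Rats_abs_nat_div_natE)
  have rot: "real b * angle c m l (pi / sqrt c) = real a * (2 * pi)"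
    using ab b angle_period_pos by (simp add: field_simps)
  define P where "P = real b * (pi / sqrt c)"
  have P: "P > 0"
    using b c by (simp add: P_def)
  define q where "q = double_rotation (\<lambda>_. 1) (\<lambda>s. 2 * pi / P * s) (\<lambda>_. 1)"
  show ?thesis
  proof (rule image_is_compact_surface_if_periodic)
    show "(vector [P, 2 * pi] :: real^2) $ i > 0" for i
      using P exhaust_2[of i] by auto
    show "smooth_immersion_on UNIV q"
      unfolding q_def
    proof (rule smooth_immersion_double_rotation[where r' = "\<lambda>_. 0" and f' = "\<lambda>_. 0"
          and \<theta>' = "\<lambda>_. 2 * pi / P"])
      show "((\<lambda>s. 2 * pi / P * s) has_real_derivative 2 * pi / P) (at s)" for s
        using DERIV_cmult[OF DERIV_ident, of "2 * pi / P"] by simp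
      show "smooth_map_on UNIV (\<lambda>s. 2 * pi / P * s)"
        by (intro smooth_mult smooth_const smooth_linear[OF bounded_linear_ident])
      show "0\<^sup>2 + (1 * (2 * pi / P))\<^sup>2 + 0\<^sup>2 > (0::real)"
        using P by simp
    qed (simp_all add: smooth_const)
    show "q p = q p' \<longleftrightarrow> period_cong (vector [P, 2 * pi]) p p'" for p p'
      unfolding q_def
    proof (rule double_rotation_eq_iff)
      show "2 * pi / P * (s + P) = 2 * pi / P * s + 2 * pi" for s
        using P by (simp add: distrib_left)
      show "inj (\<lambda>s. 2 * pi / P * s)"
        using P by (intro injI) simp
    qed simp_all
    show "rotational_surface c m l p = rotational_surface c m l p'"
      if "period_cong (vector [P, 2 * pi]) p p'" for p p'
      unfolding rotational_surface_eq
    proof (rule double_rotation_eqI[OF _ _ _ that])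
      show "angle c m l (s + P) = angle c m l s + of_int (int a) * (2 * pi)" for s
        using angle_multiple_period[of s b] rot by (simp add: P_def)
    qed (simp_all only: P_def radii_multiple_period)
  qed (rule smooth_immersion_rotational_surface range_rotational_surface)+
qed

text \<open>Here the surface winds around only once before it closes up, and so does not meet itself.\<close>
lemma embedded_surface_if_closes_up_once:
  assumes n: "n > 0" and rot: "angle c m l (pi / sqrt c) = 2 * pi / real n"
  shows "embedded_surface_in (S3 c) (range (rotational_surface c m l))"
  unfolding embedded_surface_in_def
proof
  show "range (rotational_surface c m l) \<subseteq> S3 c"
    by (rule range_rotational_surface)
  define P where "P = real n * (pi / sqrt c)"
  have P: "P > 0"
    using n c by (simp add: P_def)
  show "regular_surface (range (rotational_surface c m l))"
  proof (rule regular_surface_range_periodic_immersion[OF _ smooth_immersion_rotational_surface])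
    show "(vector [P, 2 * pi] :: real^2) $ i > 0" for i
      using P exhaust_2[of i] by auto
    show "rotational_surface c m l p = rotational_surface c m l q \<longleftrightarrow>
        period_cong (vector [P, 2 * pi]) p q" for p q
      unfolding rotational_surface_eq
    proof (rule double_rotation_eq_iff[OF first_radius_pos profile_pos])
      show "angle c m l (s + P) = angle c m l s + 2 * pi" for s
        using angle_multiple_period[of s n] rot n by (simp add: P_def)
      show "inj (angle c m l)"
        using strict_mono_angle by (rule strict_mono_imp_inj_on)
    qed (simp_all only: P_def radii_multiple_period)
  qed
qed

end

theorem theorem5p3:
  fixes c m l :: real
  assumes "c > 0" and "(m, l) \<in> Lambda' c"
  shows "spherical_ricci_surface c (warped_metric c m l) \<and>
         isometric_immersion (warped_metric c m l) (S3 c) (rotational_surface c m l) \<and>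
         (angle c m l (pi / sqrt c) / (2 * pi) \<in> \<rat> \<longrightarrow>
            image_is_compact_surface (S3 c) (rotational_surface c m l)) \<and>
         (\<forall>n::nat. 0 < n \<and> angle c m l (pi / sqrt c) = 2 * pi / real n \<longrightarrow>
            embedded_surface_in (S3 c) (range (rotational_surface c m l)))"
  using spherical_ricci_surface_warped_metric[OF assms]
    isometric_immersion_rotational_surface[OF assms] compact_surface_if_rational[OF assms]
    embedded_surface_if_closes_up_once[OF assms] by blast

end
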